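(* Let $T>0$, let $\varphi$ be a $T$-periodic z-c function with exactly $m_o$ zero-crossings per period, and let $\mathbf{L}$ be an admissible operator. Let $\mu>0$ be such that for every $T$-periodic z-c function $\psi$ the function $\varphi-\mu\,\mathbf{L}(\operatorname{sign}\psi)$ possesses the z-c features of $\varphi$. Then the equation $$f(t)=\varphi(t)-\mu\,\bigl(\mathbf{L}(\operatorname{sign} f)\bigr)(t),\qquad t\in\mathbb{R},$$ has a $T$-periodic z-c solution $f$ with exactly $m_o$ zero-crossings per period.
   Context: All functions are real-valued, $\omega=2\pi/T$, $\langle g\rangle=\frac1T\int_0^T g(t)\,dt$, and $\operatorname{sign}0=0$. A $T$-periodic z-c function is a continuous, piecewise $C^1$, $T$-periodic function, not identically zero, with zero average, all of whose zeros are zero-crossings (z-cs): isolated simple zeros $t_*$ at which the two one-sided derivatives are nonzero and have the same sign. Such a function has a finite even number $m\ge 2$ of zeros per period and changes sign at each of them. Let $\varphi$ be a $T$-periodic z-c function with zeros $t_1^o<t_2^o<\dots<t_{m_o}^o<t_1^o+T=:t_{m_o+1}^o$ in one period. A $T$-periodic function $f$ possesses the z-c features of $\varphi$ if $f$ is a $T$-periodic z-c function with exactly $m_o$ zeros per period, which can be labelled $t_1<\dots<t_{m_o}<t_1+T=:t_{m_o+1}$ so that for each $k=1,\dots,m_o$ the sign of $f$ on $(t_k,t_{k+1})$ equals the sign of $\varphi$ on $(t_k^o,t_{k+1}^o)$. An admissible operator $\mathbf{L}$ is the steady-state response operator of a linear time-invariant lossless system (convolution with a real kernel), acting on bounded measurable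 $T$-periodic functions $\zeta=\sum_n\zeta_n e^{in\omega t}$ as the Fourier multiplier $(\mathbf{L}\zeta)_n=\ell(n\omega)\,\zeta_n$, where $\ell$ is the frequency response, $\ell(-\Omega)=\overline{\ell(\Omega)}$, finite at every $\Omega=n\omega$ (no resonance), and: (i) $\mathbf{L}(1)=0$, i.e. $\ell(0)=0$, so that $\mathbf{L}\zeta$ always has zero average; (ii) there are $L_o>0$ and $d\ge2$ with $i\Omega\,\ell(\Omega)-1/L_o=O(|\Omega|^{-d})$ as $|\Omega|\to\infty$; (iii) $\langle\zeta\,\mathbf{L}\zeta\rangle=0$ for every bounded $T$-periodic $\zeta$. *)

theory Defs
  imports "HOL-Analysis.Analysis" "HOL-Library.Landau_Symbols"
begin

definition periodic :: "real \<Rightarrow> (real \<Rightarrow> 'a) \<Rightarrow> bool" where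
  "periodic T f \<longleftrightarrow> (\<forall>t. f (t + T) = f t)"

definition average :: "real \<Rightarrow> (real \<Rightarrow> real) \<Rightarrow> real" where
  "average T g = (1 / T) * integral {0..T} g"

definition fourier_coeff :: "real \<Rightarrow> (real \<Rightarrow> real) \<Rightarrow> int \<Rightarrow> complex" where
  "fourier_coeff T g n =
     (1 / of_real T) * integral {0..T}
       (\<lambda>t. of_real (g t) * exp (- (\<i> * of_int n * of_real (2 * pi / T) * of_real t)))"

text \<open>
  Piecewise \<open>C\<^sup>1\<close> means continuously differentiable on each closed cell of a finite
  partition, with one-sided derivatives at the endpoints of the cells. This is stronger than
  \<^const>\<open>piecewise_C1_differentiable_on\<close>, which allows the derivative to be unbounded near a
  breakpoint.  For a periodic function it suffices to consider the period \<open>{0..T}\<close>.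
\<close>

definition C1_on_interval :: "(real \<Rightarrow> real) \<Rightarrow> real \<Rightarrow> real \<Rightarrow> bool" where
  "C1_on_interval f a b \<longleftrightarrow>
     (\<exists>D. (\<forall>x\<in>{a..b}. (f has_real_derivative D x) (at x within {a..b})) \<and>
          continuous_on {a..b} D)"

definition piecewise_C1 :: "real \<Rightarrow> (real \<Rightarrow> real) \<Rightarrow> bool" where
  "piecewise_C1 T f \<longleftrightarrow>
     (\<exists>(n::nat) p. p 0 = 0 \<and> p n = T \<and>
        (\<forall>i<n. p i < p (Suc i) \<and> C1_on_interval f (p i) (p (Suc i))))"

definition zero_crossing :: "(real \<Rightarrow> real) \<Rightarrow> real \<Rightarrow> bool" where
  "zero_crossing f t \<longleftrightarrow>
     t isolated_in {s. f s = 0} \<and>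
     (\<exists>a b. (f has_real_derivative a) (at_left t) \<and>
            (f has_real_derivative b) (at_right t) \<and>
            a \<noteq> 0 \<and> b \<noteq> 0 \<and> sgn a = sgn b)"

definition zc_function :: "real \<Rightarrow> (real \<Rightarrow> real) \<Rightarrow> bool" where
  "zc_function T f \<longleftrightarrow>
     continuous_on UNIV f \<and> piecewise_C1 T f \<and> periodic T f \<and>
     (\<exists>t. f t \<noteq> 0) \<and> average T f = 0 \<and>
     (\<forall>t. f t = 0 \<longrightarrow> zero_crossing f t)"

definition zeros_per_period :: "real \<Rightarrow> (real \<Rightarrow> real) \<Rightarrow> nat \<Rightarrow> bool" where
  "zeros_per_period T f m \<longleftrightarrow>
     finite {t\<in>{0..<T}. f t = 0} \<and> card {t\<in>{0..<T}. f t = 0} = m"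

text \<open>
  Zeros are numbered from 0: the zeros in one period are \<open>t 0 < \<dots> < t (m - 1)\<close>, and
  \<open>t m = t 0 + T\<close> is the first zero of the next period.
\<close>

definition zero_labelling :: "real \<Rightarrow> (real \<Rightarrow> real) \<Rightarrow> nat \<Rightarrow> (nat \<Rightarrow> real) \<Rightarrow> bool" where
  "zero_labelling T f m t \<longleftrightarrow>
     (\<forall>k<m. t k < t (Suc k)) \<and> t m = t 0 + T \<and>
     {s\<in>{t 0..<t 0 + T}. f s = 0} = t ` {..<m}"

text \<open>
  Changing the labelling of \<open>\<phi>\<close> permutes the indices of its zeros cyclically, which the labelling
  of \<open>f\<close> can follow; so it does not matter which labelling of \<open>\<phi>\<close> is used below.
\<close>

definition has_zc_features :: "real \<Rightarrow> (real \<Rightarrow> real) \<Rightarrow> (real \<Rightarrow> real) \<Rightarrow> bool" where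
  "has_zc_features T \<phi> f \<longleftrightarrow>
     zc_function T f \<and>
     (\<exists>m t\<^sub>o t. zero_labelling T \<phi> m t\<^sub>o \<and> zero_labelling T f m t \<and>
        (\<forall>k<m. \<forall>x\<in>{t k<..<t (Suc k)}. \<forall>y\<in>{t\<^sub>o k<..<t\<^sub>o (Suc k)}.
           sgn (f x) = sgn (\<phi> y)))"

definition bounded_periodic :: "real \<Rightarrow> (real \<Rightarrow> real) \<Rightarrow> bool" where
  "bounded_periodic T \<zeta> \<longleftrightarrow>
     \<zeta> \<in> borel_measurable borel \<and> bounded (range \<zeta>) \<and> periodic T \<zeta>"

text \<open>
  On \<open>T\<close>-periodic inputs the steady-state response is a periodic convolution with a \<open>T\<close>-periodic
  real kernel \<open>K\<close>, whose Fourier coefficients are \<open>l (n\<omega>)\<close>. The high-frequency condition makes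
  \<open>K\<close> a sawtooth plus a \<open>C\<^sup>1\<close> function, so integrability of \<open>K\<close> is no restriction. The kernel fixes
  the pointwise values of \<open>L \<zeta>\<close>, which the Fourier coefficients fix only almost everywhere.
  The frequency response \<open>l\<close> is a total function; its values at possible resonances, which are
  never at a multiple of \<open>2 * pi / T\<close>, are irrelevant.
\<close>

definition admissible_operator :: "real \<Rightarrow> ((real \<Rightarrow> real) \<Rightarrow> real \<Rightarrow> real) \<Rightarrow> bool" where
  "admissible_operator T L \<longleftrightarrow>
     (\<exists>K. periodic T K \<and> K absolutely_integrable_on {0..T} \<and>
        (\<forall>\<zeta>. bounded_periodic T \<zeta> \<longrightarrow>
           (\<forall>t. L \<zeta> t = average T (\<lambda>s. K (t - s) * \<zeta> s)))) \<and>
     (\<exists>l :: real \<Rightarrow> complex.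
        (\<forall>\<Omega>. l (- \<Omega>) = cnj (l \<Omega>)) \<and>
        (\<forall>\<zeta>. bounded_periodic T \<zeta> \<longrightarrow>
           (\<forall>n. fourier_coeff T (L \<zeta>) n = l (of_int n * (2 * pi / T)) * fourier_coeff T \<zeta> n)) \<and>
        l 0 = 0 \<and>
        (\<exists>L\<^sub>o>0. \<exists>d::real. d \<ge> 2 \<and>
           (\<lambda>\<Omega>. norm (\<i> * of_real \<Omega> * l \<Omega> - of_real (1 / L\<^sub>o)))
             \<in> O[at_infinity](\<lambda>\<Omega>. \<bar>\<Omega>\<bar> powr (- d)))) \<and>
     L (\<lambda>t. 1) = (\<lambda>t. 0) \<and>
     (\<forall>\<zeta>. bounded_periodic T \<zeta> \<longrightarrow> average T (\<lambda>t. \<zeta> t * L \<zeta> t) = 0)"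

end

theory Submission imports Defs begin

text \<open>
  Cut a period into \<open>N\<close> cells and let \<open>x \<in> [0,1]\<^sup>N\<close> describe the wave that is \<open>-1\<close> on the leading
  fraction \<open>x\<^sub>i\<close> of cell \<open>i\<close> and \<open>1\<close> on the rest of it. Almost everywhere this wave is constant or the
  sign of a z-c function, so by hypothesis the loop output \<open>g = \<phi> - \<mu> L(wave)\<close> has exactly \<open>m\<close> simple
  zeros; hence the fraction of cell \<open>i\<close> on which \<open>g < 0\<close> depends continuously on \<open>x\<close>, and Brouwer's
  theorem yields a wave with the same cell averages as \<open>sgn g\<close>. As \<open>sgn g\<close> is constant on all but
  boundedly many cells, the wave coincides with \<open>sgn g\<close> there. Let \<open>N \<rightarrow> \<infinity>\<close> along a subsequence for
  which the \<open>m\<close> zeros and the signs between them converge: the waves and \<open>sgn g\<close> have the same limit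
  \<open>\<sigma>\<close> almost everywhere, and \<open>f = \<phi> - \<mu> L \<sigma>\<close> has only isolated zeros, so \<open>sgn f = \<sigma>\<close> almost everywhere.
\<close>

subsection \<open>Zero-crossing functions with prescribed sign\<close>

lemma periodic_add_int:
  assumes "periodic T f"
  shows "f (t + of_int j * T) = f t"
proof -
  have N: "f (t + of_nat n * T) = f t" for n t
  proof (induction n)
    case (Suc n)
    have "f (t + of_nat (Suc n) * T) = f ((t + of_nat n * T) + T)" by (simp add: algebra_simps)
    also have "\<dots> = f t" using Suc assms unfolding periodic_def by simp
    finally show ?case .
  qed simp
  show ?thesis
  proof (cases "j \<ge> 0")
    case True
    then show ?thesis using N[of t "nat j"] by simp
  next
    case False
    then show ?thesis using N[of "t + of_int j * T" "nat (-j)"] by simp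
  qed
qed

lemma int_shift_into_period:
  fixes T a t :: real
  assumes "T > 0"
  obtains j :: int where "a \<le> t + of_int j * T" "t + of_int j * T < a + T"
proof
  let ?j = "- \<lfloor>(t - a) / T\<rfloor>"
  have "of_int \<lfloor>(t - a) / T\<rfloor> \<le> (t - a) / T" "(t - a) / T < of_int \<lfloor>(t - a) / T\<rfloor> + 1"
    by linarith+
  then have "of_int \<lfloor>(t - a) / T\<rfloor> * T \<le> t - a" "t - a < (of_int \<lfloor>(t - a) / T\<rfloor> + 1) * T"
    using assms by (metis le_divide_eq pos_divide_less_eq not_less)+
  then show "a \<le> t + of_int ?j * T" "t + of_int ?j * T < a + T"
    by (simp_all add: algebra_simps)
qed

text \<open>A weight \<open>exp (l * h x)\<close> with large \<open>l\<close> favours the places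
  where \<open>h\<close> is positive. The function \<open>y * exp (l * y)\<close> is at least
  \<open>l * y^2\<close> for nonnegative \<open>y\<close> and at least \<open>- 1 / l\<close> for
  negative \<open>y\<close>, so the gain grows with \<open>l\<close> while the loss stays bounded.
  The lemma serves to correct an average without touching signs.\<close>

lemma exists_exp_weight_integral_pos:
  fixes h :: "real \<Rightarrow> real"
  assumes "T > 0" "continuous_on {0..T} h" "p \<in> {0..T}" "h p > 0"
  shows "\<exists>l. 0 < integral {0..T} (\<lambda>x. h x * exp (l * h x))"
proof -
  have key: "l * (max (y::real) 0)\<^sup>2 - 1 / l \<le> y * exp (l * y)" if "l > 0" for l y :: real
  proof (cases "y \<ge> 0")
    case True
    have "l * y \<le> exp (l * y)" using exp_ge_add_one_self[of "l * y"] by linarith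
    then have "y * (l * y) \<le> y * exp (l * y)" using True by (rule mult_left_mono)
    then have "l * y\<^sup>2 \<le> y * exp (l * y)" by (simp add: power2_eq_square algebra_simps)
    moreover have "0 \<le> 1 / l" using that by simp
    ultimately have "l * y\<^sup>2 - 1 / l \<le> y * exp (l * y)" by linarith
    then show ?thesis using True by (simp only: max_absorb1)
  next
    case False
    define z where "z = - (l * y)"
    have "z \<le> exp z" using exp_ge_add_one_self[of z] by linarith
    then have "z * exp (- z) \<le> 1"
      by (simp add: exp_minus field_simps)
    then have "- (l * y) * exp (l * y) \<le> 1" by (simp add: z_def)
    then have "- (1 / l) \<le> y * exp (l * y)" using that by (simp add: field_simps)
    then show ?thesis using False by (simp add: max_def)
  qed
  define J where "J = integral {0..T} (\<lambda>x. (max (h x) 0)\<^sup>2)"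
  have cJ: "continuous_on {0..T} (\<lambda>x. (max (h x) 0)\<^sup>2)"
    by (intro continuous_intros continuous_on_max assms)
  have "J \<noteq> 0"
    unfolding J_def using integral_eq_0_iff[OF cJ assms(1)] assms(3,4)
    by (auto simp: max_def intro!: bexI[of _ p])
  moreover have "J \<ge> 0" unfolding J_def by (rule integral_nonneg) (use cJ integrable_continuous_interval in auto)
  ultimately have J: "J > 0" by simp
  \<comment> \<open>This choice gives \<open>l * J \<ge> T + 1\<close>, which beats the possible
    loss \<open>T / l \<le> T\<close>.\<close>
  define l where "l = max 1 ((T + 1) / J)"
  have l: "l \<ge> 1" "l * J \<ge> T + 1"
    using J by (auto simp: l_def max_def field_simps)
  have i1: "(\<lambda>x. l * (max (h x) 0)\<^sup>2 - 1 / l) integrable_on {0..T}"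
    by (intro integrable_continuous_interval continuous_intros cJ)
  have i2: "(\<lambda>x. h x * exp (l * h x)) integrable_on {0..T}"
    by (intro integrable_continuous_interval continuous_intros assms)
  have "integral {0..T} (\<lambda>x. l * (max (h x) 0)\<^sup>2 - 1 / l) \<le> integral {0..T} (\<lambda>x. h x * exp (l * h x))"
    by (rule integral_le[OF i1 i2]) (use key l in auto)
  moreover have "integral {0..T} (\<lambda>x. l * (max (h x) 0)\<^sup>2 - 1 / l) = l * J - T / l"
    unfolding J_def using assms(1)
    by (subst integral_diff)
       (auto intro!: integrable_continuous_interval continuous_intros cJ)
  moreover have "T / l \<le> T" using l assms(1) by (simp add: field_simps)
  ultimately have "0 < integral {0..T} (\<lambda>x. h x * exp (l * h x))" using l by linarith
  then show ?thesis by blast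
qed

lemma zero_crossing_of_deriv_nonzero:
  assumes "(f has_real_derivative D) (at t)" "f t = 0" "D \<noteq> 0"
  shows "zero_crossing f t"
proof -
  have "((\<lambda>s. (f s - f t) / (s - t)) \<longlongrightarrow> D) (at t)"
    using assms(1) by (simp add: has_field_derivative_iff)
  then have "\<forall>\<^sub>F s in at t. (f s - f t) / (s - t) \<noteq> 0"
    using assms(3) by (rule tendsto_imp_eventually_ne)
  then have "\<forall>\<^sub>F s in at t. s \<notin> {s. f s = 0}"
    by eventually_elim (use assms(2) in auto)
  then have "\<not> t islimpt {s. f s = 0}"
    by (simp add: islimpt_iff_eventually)
  then have "t isolated_in {s. f s = 0}"
    using assms(2) by (simp add: isolated_in_islimpt_iff)
  moreover have "(f has_real_derivative D) (at_left t)" "(f has_real_derivative D) (at_right t)"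
    using assms(1) has_field_derivative_at_within by blast+
  ultimately show ?thesis unfolding zero_crossing_def using assms(3) by blast
qed

text \<open>Everything required of a z-c function is present except the zero average. Multiplying
  \<open>h\<close> by a positive smooth periodic weight keeps zeros, signs and simplicity of the
  zeros. One exponential weight makes the integral positive, another makes it negative, and a
  positive combination of the two makes it vanish.\<close>

lemma exists_zc_function_sgn_eq:
  fixes h h' :: "real \<Rightarrow> real"
  assumes T: "T > 0" and per: "periodic T h"
    and d: "\<And>t. (h has_real_derivative h' t) (at t)" and c': "continuous_on UNIV h'"
    and nz: "\<And>t. h t = 0 \<Longrightarrow> h' t \<noteq> 0"
    and p: "h p > 0" and q: "h q < 0"
  shows "\<exists>\<psi>. zc_function T \<psi> \<and> (\<forall>t. sgn (\<psi> t) = sgn (h t))"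
proof -
  have c: "continuous_on A h" for A
    by (rule continuous_on_subset[of UNIV]) (auto intro: DERIV_continuous_on d)
  have c'': "continuous_on A h'" for A
    by (rule continuous_on_subset[OF c']) auto
  obtain i where i: "0 \<le> p + of_int i * T" "p + of_int i * T < 0 + T"
    using int_shift_into_period[OF T] by metis
  obtain j where j: "0 \<le> q + of_int j * T" "q + of_int j * T < 0 + T"
    using int_shift_into_period[OF T] by metis
  obtain l1 where l1: "0 < integral {0..T} (\<lambda>x. h x * exp (l1 * h x))"
    using exists_exp_weight_integral_pos[OF T c, of "p + of_int i * T"] i p periodic_add_int[OF per]
    by auto
  obtain l2 where l2: "0 < integral {0..T} (\<lambda>x. - h x * exp (l2 * - h x))"
    using exists_exp_weight_integral_pos[OF T, of "\<lambda>x. - h x" "q + of_int j * T"]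
      c j q periodic_add_int[OF per]
    by (auto intro!: continuous_intros)
  define A where "A = integral {0..T} (\<lambda>x. h x * exp (l1 * h x))"
  define B where "B = integral {0..T} (\<lambda>x. - h x * exp (l2 * - h x))"
  \<comment> \<open>Each weighted copy of \<open>h\<close> gets the size of the other one's integral
    as coefficient, so the integral becomes \<open>B * A - A * B\<close>.\<close>
  define \<psi> where "\<psi> = (\<lambda>x. B * (h x * exp (l1 * h x)) - A * (- h x * exp (l2 * - h x)))"
  define w where "w = (\<lambda>x. B * exp (l1 * h x) + A * exp (l2 * - h x))"
  have AB: "A > 0" "B > 0" using l1 l2 by (auto simp: A_def B_def)
  have \<psi>w: "\<psi> x = w x * h x" for x by (simp add: \<psi>_def w_def algebra_simps)
  have w: "w x > 0" for x unfolding w_def using AB by (simp add: add_pos_pos)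
  have sgn: "sgn (\<psi> t) = sgn (h t)" for t using w[of t] by (simp add: \<psi>w sgn_mult)
  define w' where "w' = (\<lambda>x. B * (exp (l1 * h x) * (l1 * h' x)) + A * (exp (l2 * - h x) * (l2 * - h' x)))"
  have dw: "(w has_real_derivative w' x) (at x)" for x
    unfolding w_def w'_def by (auto intro!: derivative_eq_intros d)
  have d\<psi>: "(\<psi> has_real_derivative (w' x * h x + h' x * w x)) (at x)" for x
    using DERIV_mult[OF dw d, of x] \<psi>w by presburger
  have cw: "continuous_on A w" for A unfolding w_def by (intro continuous_intros c)
  have cw': "continuous_on A w'" for A unfolding w'_def by (intro continuous_intros c c'')
  have "integral {0..T} \<psi> = B * A - A * B"
    unfolding \<psi>_def A_def B_def
    by (subst integral_diff) (auto intro!: integrable_continuous_interval continuous_intros c)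
  then have avg: "average T \<psi> = 0" by (simp add: average_def)
  have "C1_on_interval \<psi> 0 T"
    unfolding C1_on_interval_def
    by (intro exI[of _ "\<lambda>x. w' x * h x + h' x * w x"] conjI ballI has_field_derivative_at_within[OF d\<psi>]
        continuous_intros cw cw' c c'')
  then have pw: "piecewise_C1 T \<psi>"
    unfolding piecewise_C1_def using T
    by (intro exI[of _ "1::nat"] exI[of _ "\<lambda>i. of_nat i * T"]) auto
  have zc: "zero_crossing \<psi> t" if "\<psi> t = 0" for t
  proof (rule zero_crossing_of_deriv_nonzero[OF d\<psi> that])
    have "h t = 0" using that w[of t] by (simp add: \<psi>w)
    then show "w' t * h t + h' t * w t \<noteq> 0" using nz[of t] w[of t] by simp
  qed
  have "continuous_on UNIV \<psi>" by (rule DERIV_continuous_on[OF d\<psi>])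
  moreover have "periodic T \<psi>" using per by (simp add: periodic_def \<psi>_def)
  moreover have "\<psi> p \<noteq> 0" using sgn[of p] p by (auto simp: sgn_if split: if_splits)
  ultimately have "zc_function T \<psi>"
    unfolding zc_function_def using avg pw zc by blast
  with sgn show ?thesis by blast
qed

subsection \<open>Square waves as products of half-period sines\<close>

text \<open>A smooth function with one simple zero per period, namely at the translates of
  \<open>a\<close> by multiples of \<open>T\<close>. It is antiperiodic under \<open>T\<close>, so
  products of an even number of such factors are \<open>T\<close>-periodic.\<close>

definition half_sine :: "real \<Rightarrow> real \<Rightarrow> real \<Rightarrow> real" where
  "half_sine T a s = sin (pi * (s - a) / T)"

lemma half_sine_eq_0_iff:
  assumes "T > 0"
  shows "half_sine T a s = 0 \<longleftrightarrow> (\<exists>i::int. s = a + of_int i * T)"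
proof -
  have "pi * (s - a) / T = of_int i * pi \<longleftrightarrow> s = a + of_int i * T" for i :: int
  proof -
    have "pi * (s - a) / T = of_int i * pi \<longleftrightarrow> pi * (s - a) = pi * (of_int i * T)"
      using assms by (simp add: field_simps)
    then show ?thesis by auto
  qed
  then show ?thesis by (simp add: half_sine_def sin_zero_iff_int2)
qed

lemma half_sine_eq_0_unique:
  assumes "T > 0" "a \<in> {0..<T}" "b \<in> {0..<T}" "half_sine T a s = 0" "half_sine T b s = 0"
  shows "a = b"
proof -
  obtain i j :: int where ij: "s = a + of_int i * T" "s = b + of_int j * T"
    using assms(4,5) half_sine_eq_0_iff[OF assms(1)] by metis
  then have eq: "a - b = of_int (j - i) * T" by (simp add: algebra_simps)
  have "\<bar>a - b\<bar> < T" using assms by auto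
  then have "\<bar>of_int (j - i)\<bar> * T < 1 * T" unfolding eq using assms(1) by (simp add: abs_mult)
  then have "\<bar>of_int (j - i) :: real\<bar> < 1" using assms(1) by (simp only: mult_less_cancel_right_pos)
  then have "j = i" by linarith
  then show ?thesis using eq by simp
qed

lemma half_sine_add_period: "T > 0 \<Longrightarrow> half_sine T a (s + T) = - half_sine T a s"
proof -
  assume "T > 0"
  then have "pi * (s + T - a) / T = pi * (s - a) / T + pi" by (simp add: field_simps)
  then show ?thesis by (simp add: half_sine_def)
qed

lemma half_sine_shift_int: "T > 0 \<Longrightarrow> half_sine T (a + of_int j * T) s = (if even j then 1 else -1) * half_sine T a s"
proof -
  assume "T > 0"
  then have "pi * (s - (a + of_int j * T)) / T = pi * (s - a) / T - of_int j * pi" by (simp add: field_simps)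
  then show ?thesis by (simp add: half_sine_def sin_diff mult.commute[of _ pi])
qed

lemma half_sine_pos: "T > 0 \<Longrightarrow> 0 < s - a \<Longrightarrow> s - a < T \<Longrightarrow> 0 < half_sine T a s"
  unfolding half_sine_def
  by (rule sin_gt_zero) (simp_all add: pos_divide_less_eq)

lemma half_sine_neg:
  assumes "T > 0" "0 < a - s" "a - s < T"
  shows "half_sine T a s < 0"
proof -
  have "pi * (s - a) / T = - (pi * (a - s) / T)" by (simp only: minus_diff_eq[of a s, symmetric] mult_minus_right minus_divide_left)
  then have "half_sine T a s = - half_sine T s a" unfolding half_sine_def by (metis sin_minus)
  then show ?thesis using half_sine_pos[OF assms] by simp
qed

lemma countable_half_sine_zeros:
  assumes "T > 0"
  shows "countable {s. half_sine T a s = 0}"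
proof -
  have "{s. half_sine T a s = 0} = (\<lambda>i::int. a + of_int i * T) ` UNIV"
    using assms by (auto simp: half_sine_eq_0_iff)
  then show ?thesis by simp
qed

lemma sgn_prod_real: "sgn (\<Prod>a\<in>S. f a) = (\<Prod>a\<in>S. sgn (f a :: real))"
  by (induction S rule: infinite_finite_induct) (auto simp: sgn_mult)

text \<open>Distinct switching times in one period never share a zero, so all zeros of the product
  of half sines are simple. An even number of factors makes the product periodic, and a simple zero
  forces both signs to occur; the average is then corrected by a positive weight.\<close>

lemma exists_zc_function_sgn_eq_prod_half_sine:
  assumes T: "T > 0" and S: "finite S" "S \<subseteq> {0..<T}" "S \<noteq> {}" "even (card S)" and c: "c = 1 \<or> c = (-1::real)"
  shows "\<exists>\<psi>. zc_function T \<psi> \<and> (\<forall>s. sgn (\<psi> s) = c * (\<Prod>a\<in>S. sgn (half_sine T a s)))"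
proof -
  define h where "h = (\<lambda>s. c * (\<Prod>a\<in>S. half_sine T a s))"
  define h' where "h' = (\<lambda>s. c * (\<Sum>a\<in>S. cos (pi * (s - a) / T) * (pi / T) * (\<Prod>b\<in>S - {a}. half_sine T b s)))"
  have "(half_sine T a has_real_derivative cos (pi * (s - a) / T) * (pi / T)) (at s)" for a s
    unfolding half_sine_def using T by (auto intro!: derivative_eq_intros)
  then have d: "(h has_real_derivative h' s) (at s)" for s
    unfolding h_def h'_def by (intro DERIV_cmult has_field_derivative_prod) auto
  have c': "continuous_on UNIV h'"
    unfolding h'_def half_sine_def by (intro continuous_intros) (use T in auto)
  have per: "periodic T h"
    unfolding periodic_def h_def using T S by (simp add: half_sine_add_period prod.distrib prod_uminus)
  have nz: "h' s \<noteq> 0" if "h s = 0" for s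
  proof -
    obtain a where a: "a \<in> S" "half_sine T a s = 0" using \<open>h s = 0\<close> S c by (auto simp: h_def)
    have other: "half_sine T b s \<noteq> 0" if "b \<in> S - {a}" for b
    proof
      assume "half_sine T b s = 0"
      then have "a = b"
        by (intro half_sine_eq_0_unique[OF T _ _ a(2)]) (use a that S in auto)
      then show False using that by simp
    qed
    \<comment> \<open>At a zero of the factor of \<open>a\<close>, every summand of the product rule
      that retains this factor vanishes; only the one that differentiates it survives.\<close>
    have "(\<Sum>b\<in>S. cos (pi * (s - b) / T) * (pi / T) * (\<Prod>d\<in>S - {b}. half_sine T d s)) =
        (\<Sum>b\<in>{a}. cos (pi * (s - b) / T) * (pi / T) * (\<Prod>d\<in>S - {b}. half_sine T d s))"
    proof (rule sum.mono_neutral_right)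
      show "\<forall>i\<in>S - {a}. cos (pi * (s - i) / T) * (pi / T) * (\<Prod>d\<in>S - {i}. half_sine T d s) = 0"
      proof
        fix i assume "i \<in> S - {a}"
        then have "(\<Prod>d\<in>S - {i}. half_sine T d s) = 0"
          using a S(1) by (intro prod_zero) auto
        then show "cos (pi * (s - i) / T) * (pi / T) * (\<Prod>d\<in>S - {i}. half_sine T d s) = 0" by simp
      qed
    qed (use S a in auto)
    moreover have "cos (pi * (s - a) / T) \<noteq> 0"
      using a(2) sin_cos_squared_add[of "pi * (s - a) / T"] by (auto simp: half_sine_def)
    ultimately show ?thesis using c T other S by (auto simp: h'_def)
  qed
  obtain a where a: "a \<in> S" using S by auto
  have "(\<Prod>b\<in>S. half_sine T b a) = 0"
    by (rule prod_zero) (use a S in \<open>auto simp: half_sine_def intro!: bexI[of _ a]\<close>)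
  then have ha: "h a = 0" by (simp add: h_def)
  \<comment> \<open>The nonzero derivative at the zero \<open>a\<close> yields opposite signs on its
    two sides.\<close>
  have "\<exists>p q. h p > 0 \<and> h q < 0"
  proof (cases "h' a > 0")
    case True
    show ?thesis using DERIV_pos_inc_right[OF d True] DERIV_pos_inc_left[OF d True] ha by (metis dense)
  next
    case False
    then have F: "h' a < 0" using nz[OF ha] by simp
    show ?thesis using DERIV_neg_dec_right[OF d F] DERIV_neg_dec_left[OF d F] ha by (metis dense)
  qed
  then obtain p q where "h p > 0" "h q < 0" by blast
  from exists_zc_function_sgn_eq[OF T per d c' nz this]
  obtain \<psi> where "zc_function T \<psi>" "\<forall>t. sgn (\<psi> t) = sgn (h t)" by blast
  moreover have "sgn (h t) = c * (\<Prod>a\<in>S. sgn (half_sine T a t))" for t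
    using c S(1) by (auto simp: h_def sgn_mult sgn_prod_real)
  ultimately show ?thesis by metis
qed

text \<open>Coinciding switching times cancel; the exceptional set hides the values at the cancelled
  times, and the parity of the number of switches is what makes the product periodic.\<close>

definition switching_wave :: "real \<Rightarrow> bool \<Rightarrow> (real \<Rightarrow> real) \<Rightarrow> bool" where
  "switching_wave T e f \<longleftrightarrow> (\<exists>S c E. finite S \<and> S \<subseteq> {0..<T} \<and> even (card S) = e \<and>
     (c = 1 \<or> c = -1) \<and> countable E \<and> (\<forall>s. s \<notin> E \<longrightarrow> f s = c * (\<Prod>a\<in>S. sgn (half_sine T a s))))"

text \<open>Reducing \<open>a\<close> modulo \<open>T\<close> costs at most a sign, which is
  absorbed into \<open>c\<close>. If the reduced time is new it joins \<open>S\<close>; if it is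
  already there the two factors cancel off their zeros, which join \<open>E\<close>. The parity of
  \<open>card S\<close> flips in both cases.\<close>

lemma switching_wave_step:
  assumes T: "T > 0" and f: "switching_wave T e f"
  shows "switching_wave T (\<not> e) (\<lambda>s. f s * sgn (half_sine T a s))"
proof -
  obtain S c E where S: "finite S" "S \<subseteq> {0..<T}" "even (card S) = e"
    and c: "c = 1 \<or> c = -1" and E: "countable E"
    and eq: "\<And>s. s \<notin> E \<Longrightarrow> f s = c * (\<Prod>a\<in>S. sgn (half_sine T a s))"
    using f by (auto simp: switching_wave_def)
  obtain j where j: "0 \<le> a + of_int j * T" "a + of_int j * T < 0 + T"
    using int_shift_into_period[OF T] by metis
  define a' where "a' = a + of_int j * T"
  define e' where "e' = (if even j then 1 else -1 :: real)"
  have e': "e' = 1 \<or> e' = -1" by (auto simp: e'_def)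
  have "half_sine T a' s = e' * half_sine T a s" for s
    unfolding a'_def e'_def using half_sine_shift_int[OF T] by simp
  then have sg: "sgn (half_sine T a s) = e' * sgn (half_sine T a' s)" for s
    using e' by (auto simp: sgn_mult)
  have c': "c * e' = 1 \<or> c * e' = -1" using c e' by auto
  show ?thesis
  proof (cases "a' \<in> S")
    case True
    let ?E = "E \<union> {s. half_sine T a' s = 0}"
    have "f s * sgn (half_sine T a s) = c * e' * (\<Prod>a\<in>S - {a'}. sgn (half_sine T a s))" if "s \<notin> ?E" for s
    proof -
      have "(\<Prod>a\<in>S. sgn (half_sine T a s)) = sgn (half_sine T a' s) * (\<Prod>a\<in>S - {a'}. sgn (half_sine T a s))"
        using True S(1) by (rule prod.remove[rotated])
      moreover have "sgn (half_sine T a' s) * sgn (half_sine T a' s) = 1"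
        using that by (simp add: sgn_if)
      moreover have "sgn (half_sine T a' s) * (sgn (half_sine T a' s) * z) = z" for z
        using that by (simp add: sgn_if)
      ultimately show ?thesis using that by (simp add: eq sg algebra_simps)
    qed
    moreover have "even (card (S - {a'})) = (\<not> e)"
      using True S by (metis card_Suc_Diff1 even_Suc)
    moreover have "countable ?E" using E countable_half_sine_zeros[OF T] by blast
    ultimately show ?thesis
      unfolding switching_wave_def using S c'
      by (intro exI[of _ "S - {a'}"] exI[of _ "c * e'"] exI[of _ ?E]) auto
  next
    case False
    have "f s * sgn (half_sine T a s) = c * e' * (\<Prod>a\<in>insert a' S. sgn (half_sine T a s))" if "s \<notin> E" for s
      using that False S(1) by (simp add: eq sg)
    moreover have "even (card (insert a' S)) = (\<not> e)" using False S by simp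
    moreover have "insert a' S \<subseteq> {0..<T}" using S j by (auto simp: a'_def)
    ultimately show ?thesis
      unfolding switching_wave_def using S E c'
      by (intro exI[of _ "insert a' S"] exI[of _ "c * e'"] exI[of _ E]) auto
  qed
qed

text \<open>If \<open>u k \<le> b k \<le> u k + T\<close>, the \<open>k\<close>-th pair of factors
  is -1 between \<open>u k\<close> and \<open>b k\<close>, 1 on the rest of a period, and repeats
  with period \<open>T\<close>, apart from the value 0 at the switching times. Multiplying pairs
  avoids any case distinction when switching times coincide or cross the end of the period.\<close>

definition pulse :: "real \<Rightarrow> nat \<Rightarrow> (nat \<Rightarrow> real) \<Rightarrow> (nat \<Rightarrow> real) \<Rightarrow> real \<Rightarrow> real" where
  "pulse T n u b s = (\<Prod>k<n. sgn (half_sine T (u k) s) * sgn (half_sine T (b k) s))"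

lemma switching_wave_pulse:
  assumes T: "T > 0"
  shows "switching_wave T True (pulse T n u b)"
proof (induction n)
  case 0
  show ?case unfolding switching_wave_def pulse_def
    by (intro exI[of _ "{}"] exI[of _ 1]) auto
next
  case (Suc n)
  have "pulse T (Suc n) u b = (\<lambda>s. pulse T n u b s * sgn (half_sine T (u n) s) * sgn (half_sine T (b n) s))"
    by (auto simp: pulse_def mult.assoc)
  then show ?case
    using switching_wave_step[OF T switching_wave_step[OF T Suc], of "u n" "b n"] by simp
qed

lemma mono_step_le:
  fixes u :: "nat \<Rightarrow> real"
  assumes "\<And>k. k < n \<Longrightarrow> u k \<le> u (Suc k)" "i \<le> j" "j \<le> n"
  shows "u i \<le> u j"
  using assms(2,3)
proof (induction rule: dec_induct)
  case (step k)
  then show ?case using assms(1)[of k] by simp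
qed simp

lemma exists_cell:
  fixes u :: "nat \<Rightarrow> real"
  assumes "u 0 \<le> s" "s < u n"
  shows "\<exists>k<n. u k \<le> s \<and> s < u (Suc k)"
  using assms(2)
proof (induction n)
  case (Suc n)
  show ?case
  proof (cases "s < u n")
    case True
    then show ?thesis using Suc.IH by (metis less_SucI)
  next
    case False
    then show ?thesis using Suc.prems by auto
  qed
qed (use assms in simp)

text \<open>For every other cell both switching times lie on the same side of \<open>s\<close>
  within one period, so the two signs of its pair agree and multiply to 1. Only the pair of cell
  \<open>k\<close> can separate its switching times by \<open>s\<close>.\<close>

lemma pulse_on_cell:
  assumes T: "T > 0" and u: "\<And>k. k < n \<Longrightarrow> u k \<le> u (Suc k)" "u n = u 0 + T"
    and b: "\<And>k. k < n \<Longrightarrow> u k \<le> b k \<and> b k \<le> u (Suc k)"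
    and k: "k < n" and s: "u k < s" "s < u (Suc k)" "s \<noteq> b k"
  shows "pulse T n u b s = (if s < b k then -1 else 1)"
proof -
  note mono = mono_step_le[of n u, OF u(1)]
  have rng: "u 0 \<le> u i \<and> u i \<le> u 0 + T" if "i \<le> n" for i
    using mono[of 0 i] mono[of i n] that u(2) by auto
  have s0: "u 0 < s" "s < u 0 + T"
    using rng[of k] rng[of "Suc k"] k s by auto
  have pos: "sgn (half_sine T a s) = 1" if "u 0 \<le> a" "a < s" for a
    using half_sine_pos[OF T, of s a] that s0 by simp
  have neg: "sgn (half_sine T a s) = -1" if "s < a" "a \<le> u 0 + T" for a
    using half_sine_neg[OF T, of a s] that s0 by simp
  have other: "sgn (half_sine T (u j) s) * sgn (half_sine T (b j) s) = 1" if "j < n" "j \<noteq> k" for j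
  proof (cases "j < k")
    case True
    then have "b j \<le> u k" using mono[of "Suc j" k] b[of j] k by force
    then show ?thesis using pos[of "u j"] pos[of "b j"] rng[of j] b[of j] that s by auto
  next
    case False
    then have "u (Suc k) \<le> u j" using mono[of "Suc k" j] that by auto
    then show ?thesis
      using neg[of "u j"] neg[of "b j"] rng[of "Suc j"] b[of j] that s by auto
  qed
  have "pulse T n u b s = sgn (half_sine T (u k) s) * sgn (half_sine T (b k) s) *
      (\<Prod>j\<in>{..<n} - {k}. sgn (half_sine T (u j) s) * sgn (half_sine T (b j) s))"
    unfolding pulse_def by (rule prod.remove) (use k in auto)
  also have "(\<Prod>j\<in>{..<n} - {k}. sgn (half_sine T (u j) s) * sgn (half_sine T (b j) s)) = 1"
    by (rule prod.neutral) (use other in auto)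
  finally show ?thesis
    using pos[of "u k"] pos[of "b k"] neg[of "b k"] rng[of k] rng[of "Suc k"] b[OF k] s k by auto
qed

lemma periodic_pulse: "T > 0 \<Longrightarrow> periodic T (pulse T n u b)"
  by (simp add: periodic_def pulse_def half_sine_add_period sgn_minus)

lemma abs_pulse_le_1: "\<bar>pulse T n u b s\<bar> \<le> 1"
  unfolding pulse_def abs_prod by (rule prod_le_1) (auto simp: abs_mult sgn_if)

lemma bounded_periodic_pulse:
  assumes "T > 0"
  shows "bounded_periodic T (pulse T n u b)"
proof -
  have "pulse T n u b \<in> borel_measurable borel"
    unfolding pulse_def half_sine_def by measurable
  moreover have "bounded (range (pulse T n u b))"
    by (rule boundedI[of _ 1]) (use abs_pulse_le_1 in auto)
  ultimately show ?thesis using periodic_pulse[OF assms] by (simp add: bounded_periodic_def)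
qed

subsection \<open>Integrals of periodic functions\<close>

lemma negligible_countable_real:
  fixes E :: "real set"
  assumes "countable E"
  shows "negligible E"
proof -
  have "negligible (\<Union>x\<in>E. {x})"
    by (rule negligible_countable_Union) (use assms in auto)
  then show ?thesis by simp
qed

text \<open>Dominated convergence, after setting all functions to 0 on the negligible set
  \<open>E\<close> so that convergence holds everywhere.\<close>

lemma tendsto_integral_off_countable:
  fixes f :: "nat \<Rightarrow> real \<Rightarrow> real"
  assumes f: "\<And>k. f k integrable_on S" and h: "h integrable_on S"
    and le: "\<And>k x. x \<in> S \<Longrightarrow> norm (f k x) \<le> h x"
    and E: "countable E" and conv: "\<And>x. x \<in> S \<Longrightarrow> x \<notin> E \<Longrightarrow> (\<lambda>k. f k x) \<longlonglongrightarrow> g x"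
  shows "(\<lambda>k. integral S (f k)) \<longlonglongrightarrow> integral S g"
proof -
  have N: "negligible E" using E by (rule negligible_countable_real)
  let ?r = "\<lambda>g x. if x \<in> E then 0 else g x :: real"
  have "(\<lambda>k. integral S (?r (f k))) \<longlonglongrightarrow> integral S (?r g)"
  proof (rule dominated_convergence(2)[OF _ h])
    show "?r (f k) integrable_on S" for k
      by (rule integrable_spike[OF f N]) auto
    fix k x assume x: "x \<in> S"
    then show "norm (?r (f k) x) \<le> h x"
      using le[OF x, of k] norm_ge_zero[of "f k x"] by (cases "x \<in> E") simp_all
    show "(\<lambda>k. ?r (f k) x) \<longlonglongrightarrow> ?r g x" using conv[OF x] by auto
  qed
  moreover have "integral S (?r g) = integral S g" for g
    by (rule integral_spike[OF N]) auto
  ultimately show ?thesis by simp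
qed

lemma integrable_reflect_shift:
  fixes f :: "real \<Rightarrow> real"
  assumes "f integrable_on {a..b}"
  shows "(\<lambda>x. f (c - x)) integrable_on {c - b..c - a}"
proof -
  have "(\<lambda>x. f (- x)) integrable_on {- b..- a}" using assms by simp
  from integrable_shift_real_ivl[OF this, of "- c"] show ?thesis by (simp add: algebra_simps)
qed

text \<open>With \<open>r\<close> the residue of \<open>t\<close> modulo \<open>T\<close>, the
  reflected period is cut at \<open>r\<close>. Reflection in \<open>r\<close> maps
  \<open>{0..r}\<close> to itself, and after adding a period, \<open>r + T - s\<close> maps
  \<open>{r..T}\<close> to itself.\<close>

lemma integrable_periodic_reflect:
  fixes f :: "real \<Rightarrow> real"
  assumes T: "T > 0" and per: "periodic T f" and f: "f integrable_on {0..T}"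
  shows "(\<lambda>s. f (t - s)) integrable_on {0..T}"
proof -
  obtain j where j: "0 \<le> t + of_int j * T" "t + of_int j * T < 0 + T"
    using int_shift_into_period[OF T] by metis
  define r where "r = t + of_int j * T"
  have r: "0 \<le> r" "r < T" using j by (auto simp: r_def)
  have eq: "f (t - s) = f (r - s)" for s
    using periodic_add_int[OF per, of "t - s" j] by (simp add: r_def algebra_simps)
  have eq': "f (r - s) = f (r + T - s)" for s
    using per[unfolded periodic_def, rule_format, of "r - s"] by (simp add: algebra_simps)
  have "f integrable_on {0..r}" "f integrable_on {r..T}"
    using integrable_subinterval_real[OF f] r by auto
  from integrable_reflect_shift[OF this(1), of r] integrable_reflect_shift[OF this(2), of "r + T"]
  have "(\<lambda>s. f (r - s)) integrable_on {0..r}" "(\<lambda>s. f (r - s)) integrable_on {r..T}"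
    by (simp_all add: eq')
  then have "(\<lambda>s. f (r - s)) integrable_on {0..T}"
    using Henstock_Kurzweil_Integration.integrable_combine[of 0 r T "\<lambda>s. f (r - s)"] r by simp
  then show ?thesis by (simp add: eq)
qed

lemma absolutely_integrable_periodic_reflect:
  fixes f :: "real \<Rightarrow> real"
  assumes T: "T > 0" and per: "periodic T f" and f: "f absolutely_integrable_on {0..T}"
  shows "(\<lambda>s. f (t - s)) absolutely_integrable_on {0..T}"
proof -
  have "(\<lambda>s. f (t - s)) integrable_on {0..T}"
    by (rule integrable_periodic_reflect[OF T per]) (use f in \<open>simp add: absolutely_integrable_on_def\<close>)
  moreover have "(\<lambda>s. norm (f (t - s))) integrable_on {0..T}"
    by (rule integrable_periodic_reflect[OF T, of "\<lambda>s. norm (f s)"])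
       (use per f in \<open>auto simp: periodic_def absolutely_integrable_on_def\<close>)
  ultimately show ?thesis by (simp add: absolutely_integrable_on_def)
qed

subsection \<open>Zero labellings\<close>

text \<open>Reduction modulo \<open>T\<close> into either window inverts reduction into the other.
  This compares a labelling, whose window starts at its first zero, with a count over
  \<open>{0..<T}\<close>.\<close>

lemma bij_betw_zeros_in_period:
  fixes f :: "real \<Rightarrow> real"
  assumes T: "T > 0" and per: "periodic T f"
  shows "\<exists>g. bij_betw g {s\<in>{a..<a+T}. f s = 0} {s\<in>{0..<T}. f s = 0}"
proof -
  define g where "g b s = s - of_int \<lfloor>(s - b) / T\<rfloor> * T" for b s
  have g: "b \<le> g b s" "g b s < b + T" for b s
  proof -
    have "of_int \<lfloor>(s - b) / T\<rfloor> \<le> (s - b) / T" "(s - b) / T < of_int \<lfloor>(s - b) / T\<rfloor> + 1"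
      by linarith+
    then have "of_int \<lfloor>(s - b) / T\<rfloor> * T \<le> s - b" "s - b < (of_int \<lfloor>(s - b) / T\<rfloor> + 1) * T"
      using T by (metis le_divide_eq pos_divide_less_eq not_less)+
    then show "b \<le> g b s" "g b s < b + T" by (simp_all add: g_def algebra_simps)
  qed
  have f: "f (g b s) = f s" for b s
    using periodic_add_int[OF per, of s "- \<lfloor>(s - b) / T\<rfloor>"] by (simp add: g_def)
  have inv: "g b (g c s) = s" if "b \<le> s" "s < b + T" for b c s
  proof -
    have "g c s - b = (s - b) - of_int \<lfloor>(s - c) / T\<rfloor> * T" by (simp add: g_def)
    then have "(g c s - b) / T = (s - b) / T - of_int \<lfloor>(s - c) / T\<rfloor>"
      using T by (simp add: diff_divide_distrib)
    moreover have "0 \<le> (s - b) / T" "(s - b) / T < 1" using that T by simp_all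
    ultimately have "\<lfloor>(g c s - b) / T\<rfloor> = - \<lfloor>(s - c) / T\<rfloor>" by linarith
    then show ?thesis by (simp add: g_def[of b] g_def[of c])
  qed
  have "bij_betw (g 0) {s\<in>{a..<a+T}. f s = 0} {s\<in>{0..<T}. f s = 0}"
  proof (rule bij_betw_byWitness[where f' = "g a"])
    show "\<forall>s\<in>{s\<in>{a..<a+T}. f s = 0}. g a (g 0 s) = s" "\<forall>s\<in>{s\<in>{0..<T}. f s = 0}. g 0 (g a s) = s"
      using inv[of a _ 0] inv[of 0 _ a] by simp_all
    show "g 0 ` {s\<in>{a..<a+T}. f s = 0} \<subseteq> {s\<in>{0..<T}. f s = 0}"
      "g a ` {s\<in>{0..<T}. f s = 0} \<subseteq> {s\<in>{a..<a+T}. f s = 0}"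
      using g[of 0] g[of a] by (auto simp: f)
  qed
  then show ?thesis by blast
qed

lemma zero_labellingD:
  assumes "zero_labelling T f m t"
  shows "k < m \<Longrightarrow> t k < t (Suc k)" "t m = t 0 + T"
    and "t 0 \<le> s \<Longrightarrow> s < t 0 + T \<Longrightarrow> f s = 0 \<longleftrightarrow> s \<in> t ` {..<m}"
    and "{s\<in>{t 0..<t 0 + T}. f s = 0} = t ` {..<m}"
proof -
  note D = assms[unfolded zero_labelling_def]
  note * = D[THEN conjunct1] D[THEN conjunct2, THEN conjunct1]
  note eq = D[THEN conjunct2, THEN conjunct2]
  show "k < m \<Longrightarrow> t k < t (Suc k)" "t m = t 0 + T" using * by simp_all
  show "{s\<in>{t 0..<t 0 + T}. f s = 0} = t ` {..<m}" by (rule eq)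
  show "f s = 0 \<longleftrightarrow> s \<in> t ` {..<m}" if "t 0 \<le> s" "s < t 0 + T"
    unfolding eq[symmetric] using that by simp
qed

lemma zero_labelling_mono:
  assumes "zero_labelling T f m t" "i \<le> j" "j \<le> m"
  shows "t i \<le> t j"
  by (rule mono_step_le[of m t, OF less_imp_le[OF zero_labellingD(1)[OF assms(1)]] assms(2,3)])

text \<open>A labelling is strictly increasing over its \<open>m\<close> indices, hence injective,
  so \<open>m\<close> is the number of zeros in a period. This identifies the unspecified count in
  \<open>has_zc_features\<close> with the prescribed one.\<close>

lemma zeros_per_period_iff:
  assumes T: "T > 0" and per: "periodic T f" and lab: "zero_labelling T f m t"
  shows "zeros_per_period T f n \<longleftrightarrow> n = m"
proof -
  obtain g where g: "bij_betw g {s\<in>{t 0..<t 0+T}. f s = 0} {s\<in>{0..<T}. f s = 0}"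
    using bij_betw_zeros_in_period[OF T per] by blast
  have lt: "t i < t j" if "i < j" "j < m" for i j
    using zero_labellingD(1)[OF lab, of i] zero_labelling_mono[OF lab, of "Suc i" j] that by linarith
  have "inj_on t {..<m}"
  proof (rule inj_onI)
    fix i j assume "i \<in> {..<m}" "j \<in> {..<m}" "t i = t j"
    then show "i = j" using lt[of i j] lt[of j i] by (cases i j rule: linorder_cases) simp_all
  qed
  then have "card (t ` {..<m}) = m" by (simp add: card_image)
  then have "card {s\<in>{0..<T}. f s = 0} = m" "finite {s\<in>{0..<T}. f s = 0}"
    using bij_betw_same_card[OF g] bij_betw_finite[OF g] unfolding zero_labellingD(4)[OF lab]
    by simp_all
  then show ?thesis unfolding zeros_per_period_def by blast
qed

lemma nonzero_between_labelled_zeros: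
  assumes lab: "zero_labelling T f m t" and k: "k < m" and x: "t k < x" "x < t (Suc k)"
  shows "f x \<noteq> 0"
proof
  assume "f x = 0"
  have le: "t 0 \<le> t k" by (rule zero_labelling_mono[OF lab]) (use k in simp_all)
  have ge: "t (Suc k) \<le> t 0 + T"
    unfolding zero_labellingD(2)[OF lab, symmetric]
    by (rule zero_labelling_mono[OF lab]) (use k in simp_all)
  have "x \<in> t ` {..<m}"
    using zero_labellingD(3)[OF lab, of x] \<open>f x = 0\<close> le ge x by linarith
  then obtain j where j: "j < m" "x = t j" by (elim imageE) simp
  show False
  proof (cases "j \<le> k")
    case True
    then have "t j \<le> t k" by (rule zero_labelling_mono[OF lab]) (use k in simp)
    then show ?thesis using x j by simp
  next
    case False
    then have "t (Suc k) \<le> t j" by (intro zero_labelling_mono[OF lab]) (use j in simp_all)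
    then show ?thesis using x j by simp
  qed
qed

text \<open>The signs are stored as real numbers so that they can be sent to a limit together with
  the zeros.\<close>

definition sign_labelling :: "real \<Rightarrow> (real \<Rightarrow> real) \<Rightarrow> nat \<Rightarrow> (nat \<Rightarrow> real) \<Rightarrow> (nat \<Rightarrow> real) \<Rightarrow> bool" where
  "sign_labelling T f m t \<epsilon> \<longleftrightarrow> zero_labelling T f m t \<and>
     (\<forall>k<m. \<bar>\<epsilon> k\<bar> = 1 \<and> (\<forall>x\<in>{t k<..<t (Suc k)}. sgn (f x) = \<epsilon> k))"

text \<open>This permits normalising the first zero into \<open>{0..<T}\<close>, which bounds all
  labelled zeros and so makes compactness available.\<close>

lemma sign_labelling_shift:
  assumes per: "periodic T f" and lab: "sign_labelling T f m t \<epsilon>"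
  shows "sign_labelling T f m (\<lambda>k. t k + of_int j * T) \<epsilon>"
proof -
  define d where "d = of_int j * T"
  have f: "f (s - d) = f s" "f (s + d) = f s" for s
    using periodic_add_int[OF per, of s "-j"] periodic_add_int[OF per, of s j] by (simp_all add: d_def)
  have zl: "zero_labelling T f m t" and sg: "\<And>k. k < m \<Longrightarrow> \<bar>\<epsilon> k\<bar> = 1"
    "\<And>k x. k < m \<Longrightarrow> t k < x \<Longrightarrow> x < t (Suc k) \<Longrightarrow> sgn (f x) = \<epsilon> k"
    using lab by (auto simp: sign_labelling_def)
  have z: "{s\<in>{t 0 + d..<t 0 + d + T}. f s = 0} = (\<lambda>k. t k + d) ` {..<m}"
  proof -
    have "s \<in> {s\<in>{t 0 + d..<t 0 + d + T}. f s = 0} \<longleftrightarrow> s - d \<in> {s\<in>{t 0..<t 0 + T}. f s = 0}" for s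
      using f(1)[of s] by auto
    also have "\<dots> s \<longleftrightarrow> s - d \<in> t ` {..<m}" for s
      using zl by (simp add: zero_labelling_def)
    also have "\<dots> s \<longleftrightarrow> s \<in> (\<lambda>k. t k + d) ` {..<m}" for s
      by (auto simp: image_iff algebra_simps)
    finally show ?thesis by blast
  qed
  have "zero_labelling T f m (\<lambda>k. t k + d)"
    unfolding zero_labelling_def z using zl by (simp add: zero_labelling_def)
  moreover have "sgn (f x) = \<epsilon> k" if "k < m" "t k + d < x" "x < t (Suc k) + d" for k x
    using sg(2)[of k "x - d"] that f(1)[of x] by simp
  ultimately show ?thesis
    using sg(1) by (auto simp: sign_labelling_def d_def)
qed

subsection \<open>Brouwer's theorem in a variable number of dimensions\<close>

text \<open>Bolzano-Weierstrass one coordinate at a time: refining the subsequence for a new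
  coordinate preserves the convergence of the earlier ones.\<close>

lemma bounded_coordinates_convergent_subsequence:
  fixes X :: "nat \<Rightarrow> nat \<Rightarrow> real"
  assumes "\<And>k i. i < n \<Longrightarrow> \<bar>X k i\<bar> \<le> B"
  obtains r l where "strict_mono r" "\<And>i. i < n \<Longrightarrow> (\<lambda>k. X (r k) i) \<longlonglongrightarrow> l i"
proof -
  have "\<exists>r l. strict_mono (r :: nat \<Rightarrow> nat) \<and> (\<forall>i<n. (\<lambda>k. X (r k) i) \<longlonglongrightarrow> l i)"
    using assms
  proof (induction n)
    case 0
    show ?case using strict_mono_id by auto
  next
    case (Suc n)
    then obtain r l where r: "strict_mono (r :: nat \<Rightarrow> nat)" and l: "\<And>i. i < n \<Longrightarrow> (\<lambda>k. X (r k) i) \<longlonglongrightarrow> l i"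
      by (metis less_SucI)
    have "\<forall>k. X (r k) n \<in> {-B..B}"
    proof
      fix k
      show "X (r k) n \<in> {-B..B}" using Suc.prems[of n "r k"] by (simp add: abs_le_iff)
    qed
    then obtain a q where q: "strict_mono (q :: nat \<Rightarrow> nat)" and a: "((\<lambda>k. X (r k) n) \<circ> q) \<longlonglongrightarrow> a"
      using compact_Icc[of "-B" B, unfolded compact_def, rule_format, of "\<lambda>k. X (r k) n"] by metis
    have "(\<lambda>k. X ((r \<circ> q) k) i) \<longlonglongrightarrow> (l(n := a)) i" if "i < Suc n" for i
    proof (cases "i = n")
      case True
      then show ?thesis using a by (simp add: o_def)
    next
      case False
      then have "(\<lambda>k. X (r k) i) \<longlonglongrightarrow> l i" using l that by simp
      from LIMSEQ_subseq_LIMSEQ[OF this q] False show ?thesis by (simp add: o_def)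
    qed
    then show ?case using strict_mono_o[OF r q] by blast
  qed
  then show ?thesis using that by blast
qed

text \<open>The dimension is a number here because the cell count must tend to infinity. On a grid
  of mesh \<open>1 / Suc k\<close> each coordinate is labelled by whether \<open>F\<close> moves it
  up or down; Kuhn's lemma gives a small cube whose corners show both labels in every coordinate. As
  the mesh shrinks these cubes converge along a subsequence, and continuity turns the two opposite
  inequalities into equality.\<close>

lemma brouwer_unit_cube_nat:
  fixes F :: "(nat \<Rightarrow> real) \<Rightarrow> nat \<Rightarrow> real"
  assumes range: "\<And>x i. (\<And>j. j < n \<Longrightarrow> 0 \<le> x j \<and> x j \<le> 1) \<Longrightarrow> i < n \<Longrightarrow> 0 \<le> F x i \<and> F x i \<le> 1"
    and cont: "\<And>X x i. (\<And>k j. j < n \<Longrightarrow> 0 \<le> X k j \<and> X k j \<le> 1) \<Longrightarrow>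
      (\<And>j. j < n \<Longrightarrow> (\<lambda>k. X k j) \<longlonglongrightarrow> x j) \<Longrightarrow> i < n \<Longrightarrow> (\<lambda>k. F (X k) i) \<longlonglongrightarrow> F x i"
  shows "\<exists>x. \<forall>i<n. 0 \<le> x i \<and> x i \<le> 1 \<and> F x i = x i"
proof -
  define G where "G k y = (\<lambda>i::nat. real (y i) / real (Suc k))" for k and y :: "nat \<Rightarrow> nat"
  define Q where "Q k q i a b \<longleftrightarrow>
      (\<forall>j<n. q j \<le> a j \<and> a j \<le> q j + 1) \<and> (\<forall>j<n. q j \<le> b j \<and> b j \<le> q j + 1) \<and>
      G k a i \<le> F (G k a) i \<and> F (G k b) i \<le> G k b i" for k q i a b
  have "\<exists>q. (\<forall>i<n. q i < Suc k) \<and> (\<forall>i<n. \<exists>a b. Q k q i a b)" for k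
  proof -
    \<comment> \<open>The first conjunct forces label 1 on the upper faces, as Kuhn's lemma
      requires. On the lower faces label 0 is automatic because \<open>F\<close> is
      nonnegative.\<close>
    define lab where "lab y i = (if y i < Suc k \<and> G k y i \<le> F (G k y) i then 0 else (1::nat))" for y i
    have G: "0 \<le> G k y j \<and> G k y j \<le> 1" if "\<And>i. i < n \<Longrightarrow> y i \<le> Suc k" "j < n" for y j
      using that(1)[OF that(2)] by (simp add: G_def)
    have FG: "0 \<le> F (G k y) i \<and> F (G k y) i \<le> 1" if "\<And>i. i < n \<Longrightarrow> y i \<le> Suc k" "i < n" for y i
      using range[of "G k y" i] G that by blast
    have l1: "\<forall>y. (\<forall>i<n. y i \<le> Suc k) \<longrightarrow> (\<forall>i<n. lab y i = 0 \<or> lab y i = 1)" by (simp add: lab_def)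
    have l2: "\<forall>y. (\<forall>i<n. y i \<le> Suc k) \<longrightarrow> (\<forall>i<n. y i = 0 \<longrightarrow> lab y i = 0)"
    proof (intro allI impI)
      fix y i assume "\<forall>i<n. y i \<le> Suc k" "i < n" "y i = 0"
      then show "lab y i = 0" using FG[of y i] by (simp add: lab_def G_def)
    qed
    have l3: "\<forall>y. (\<forall>i<n. y i \<le> Suc k) \<longrightarrow> (\<forall>i<n. y i = Suc k \<longrightarrow> lab y i = 1)" by (simp add: lab_def)
    obtain q where q: "\<forall>i<n. q i < Suc k"
      and rs: "\<forall>i<n. \<exists>r s. (\<forall>j<n. q j \<le> r j \<and> r j \<le> q j + 1) \<and> (\<forall>j<n. q j \<le> s j \<and> s j \<le> q j + 1) \<and> lab r i \<noteq> lab s i"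
      by (rule kuhn_lemma[OF zero_less_Suc l1 l2 l3])
    have "\<exists>a b. Q k q i a b" if i: "i < n" for i
    proof -
      obtain r s where r: "\<forall>j<n. q j \<le> r j \<and> r j \<le> q j + 1" and s: "\<forall>j<n. q j \<le> s j \<and> s j \<le> q j + 1"
        and ne: "lab r i \<noteq> lab s i"
        using rs i by blast
      have lab01: "lab y i = 0 \<or> lab y i = 1" for y by (simp add: lab_def)
      define a where "a = (if lab r i = 0 then r else s)"
      define b where "b = (if lab r i = 0 then s else r)"
      have a: "\<forall>j<n. q j \<le> a j \<and> a j \<le> q j + 1" and b: "\<forall>j<n. q j \<le> b j \<and> b j \<le> q j + 1"
        using r s by (simp_all add: a_def b_def)
      have "lab a i = 0" "lab b i = 1"
        using lab01[of r] lab01[of s] ne by (auto simp: a_def b_def)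
      then have Ga: "G k a i \<le> F (G k a) i" and *: "\<not> (b i < Suc k \<and> G k b i \<le> F (G k b) i)"
        by (simp_all add: lab_def split: if_splits)
      have bk: "b j \<le> Suc k" if "j < n" for j using b[rule_format, OF that] q[rule_format, OF that] by linarith
      \<comment> \<open>Label 1 arises in two ways: either \<open>F\<close> moves the coordinate
        down, or the point is on the upper face, where the coordinate equals 1 and \<open>F\<close>
        is at most 1.\<close>
      have "F (G k b) i \<le> G k b i"
      proof (cases "b i < Suc k")
        case True
        then show ?thesis using * by linarith
      next
        case False
        then have "b i = Suc k" using bk[OF i] by simp
        then show ?thesis using FG[of b i] bk i by (simp add: G_def)
      qed
      then have "Q k q i a b" unfolding Q_def using a b Ga by (intro conjI)
      then show ?thesis by (intro exI)
    qed
    then show ?thesis using q by (intro exI[of _ q] conjI) simp_all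
  qed
  then obtain q where q: "\<And>k i. i < n \<Longrightarrow> q k i < Suc k" and ex: "\<And>k i. i < n \<Longrightarrow> \<exists>a b. Q k (q k) i a b"
    by metis
  define a where "a k i = (SOME a. \<exists>b. Q k (q k) i a b)" for k i
  define b where "b k i = (SOME b. Q k (q k) i (a k i) b)" for k i
  have Q: "Q k (q k) i (a k i) (b k i)" if "i < n" for k i
  proof -
    have "\<exists>b. Q k (q k) i (a k i) b" unfolding a_def by (rule someI_ex[OF ex[OF that]])
    then show ?thesis unfolding b_def by (rule someI_ex)
  qed
  have ab: "q k j \<le> a k i j \<and> a k i j \<le> q k j + 1" "q k j \<le> b k i j \<and> b k i j \<le> q k j + 1"
    if "i < n" "j < n" for k i j
    using Q[OF that(1), of k] that(2) unfolding Q_def by simp_all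
  have F: "G k (a k i) i \<le> F (G k (a k i)) i" "F (G k (b k i)) i \<le> G k (b k i) i" if "i < n" for k i
    using Q[OF that] unfolding Q_def by simp_all
  have "\<bar>G k (q k) i\<bar> \<le> 1" if "i < n" for k i
    using q[OF that, of k] by (simp add: G_def)
  then obtain r x where r: "strict_mono r" and x: "\<And>i. i < n \<Longrightarrow> (\<lambda>k. G (r k) (q (r k)) i) \<longlonglongrightarrow> x i"
    by (rule bounded_coordinates_convergent_subsequence[of n "\<lambda>k. G k (q k)" 1]) auto
  have lim0: "(\<lambda>k. 1 / real (Suc (r k))) \<longlonglongrightarrow> 0"
    using LIMSEQ_subseq_LIMSEQ[OF LIMSEQ_inverse_real_of_nat r] by (simp add: o_def inverse_eq_divide)
  \<comment> \<open>Corners of the small cubes differ from the base corner by at most the mesh, so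
    they share its limit.\<close>
  have near: "(\<lambda>k. G (r k) (y k) j) \<longlonglongrightarrow> x j"
    if "\<And>k. q (r k) j \<le> y k j \<and> y k j \<le> q (r k) j + 1" "j < n" for y j
  proof (rule tendsto_sandwich[OF _ _ x[OF that(2)]])
    show "(\<lambda>k. G (r k) (q (r k)) j + 1 / real (Suc (r k))) \<longlonglongrightarrow> x j"
      using tendsto_add[OF x[OF that(2)] lim0] by simp
    have "real (q (r k) j) \<le> real (y k j)" "real (y k j) \<le> real (q (r k) j) + 1" for k
      using that(1)[of k] by linarith+
    then show "\<forall>\<^sub>F k in sequentially. G (r k) (q (r k)) j \<le> G (r k) (y k) j"
      "\<forall>\<^sub>F k in sequentially. G (r k) (y k) j \<le> G (r k) (q (r k)) j + 1 / real (Suc (r k))"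
      by (simp_all add: G_def divide_right_mono flip: add_divide_distrib)
  qed
  have unit: "0 \<le> G k y j \<and> G k y j \<le> 1" if "y j \<le> q k j + 1" "j < n" for k y j
    using that(1) q[OF that(2), of k] by (simp add: G_def)
  have "0 \<le> x i \<and> x i \<le> 1 \<and> F x i = x i" if i: "i < n" for i
  proof -
    have A: "(\<lambda>k. G (r k) (a (r k) i) j) \<longlonglongrightarrow> x j" if "j < n" for j
      using near[of j "\<lambda>k. a (r k) i"] ab(1)[OF i that] that by simp
    have B: "(\<lambda>k. G (r k) (b (r k) i) j) \<longlonglongrightarrow> x j" if "j < n" for j
      using near[of j "\<lambda>k. b (r k) i"] ab(2)[OF i that] that by simp
    have uA: "0 \<le> G (r k) (a (r k) i) j \<and> G (r k) (a (r k) i) j \<le> 1" if "j < n" for k j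
      by (rule unit[OF _ that]) (use ab(1)[OF i that] in simp)
    have uB: "0 \<le> G (r k) (b (r k) i) j \<and> G (r k) (b (r k) i) j \<le> 1" if "j < n" for k j
      by (rule unit[OF _ that]) (use ab(2)[OF i that] in simp)
    have FA: "(\<lambda>k. F (G (r k) (a (r k) i)) i) \<longlonglongrightarrow> F x i"
      by (rule cont[of "\<lambda>k. G (r k) (a (r k) i)", OF uA A i])
    have FB: "(\<lambda>k. F (G (r k) (b (r k) i)) i) \<longlonglongrightarrow> F x i"
      by (rule cont[of "\<lambda>k. G (r k) (b (r k) i)", OF uB B i])
    have "x i \<le> F x i" by (rule LIMSEQ_le[OF A[OF i] FA]) (use F(1)[OF i] in simp)
    moreover have "F x i \<le> x i" by (rule LIMSEQ_le[OF FB B[OF i]]) (use F(2)[OF i] in simp)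
    moreover have "0 \<le> x i" by (rule LIMSEQ_le_const[OF A[OF i]]) (use uA[OF i] in simp)
    moreover have "x i \<le> 1" by (rule LIMSEQ_le_const2[OF A[OF i]]) (use uA[OF i] in simp)
    ultimately show ?thesis by simp
  qed
  then show ?thesis by blast
qed

subsection \<open>The relay feedback loop\<close>

text \<open>Fixing a kernel gives an integral formula for \<open>L \<zeta>\<close> at every single
  time, so that the loop equation can be proved pointwise.\<close>

locale relay_loop =
  fixes T \<mu> :: real and \<phi> K :: "real \<Rightarrow> real"
    and L :: "(real \<Rightarrow> real) \<Rightarrow> real \<Rightarrow> real" and m :: nat
  assumes T_pos: "T > 0"
    and K_periodic: "periodic T K"
    and K_integrable: "K absolutely_integrable_on {0..T}"
    and L_eq: "\<And>\<zeta> t. bounded_periodic T \<zeta> \<Longrightarrow> L \<zeta> t = average T (\<lambda>s. K (t - s) * \<zeta> s)"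
    and L_one: "L (\<lambda>t. 1) = (\<lambda>t. 0)"
    and \<phi>_zc: "zc_function T \<phi>"
    and \<phi>_zeros: "zeros_per_period T \<phi> m"
    and features: "\<And>\<psi>. zc_function T \<psi> \<Longrightarrow> has_zc_features T \<phi> (\<lambda>t. \<phi> t - \<mu> * L (\<lambda>s. sgn (\<psi> s)) t)"
begin

section \<open>Null-set invariance and continuity of the operator\<close>

lemma kernel_product_integrable:
  assumes "bounded_periodic T \<zeta>"
  shows "(\<lambda>s. K (t - s) * \<zeta> s) integrable_on {0..T}"
proof -
  have "\<zeta> \<in> borel_measurable (lebesgue_on {0..T})"
    using assms by (intro measurable_restrict_space1 measurable_completion) (simp add: bounded_periodic_def)
  moreover have "bounded (\<zeta> ` {0..T})"
    by (rule bounded_subset[of "range \<zeta>"]) (use assms in \<open>auto simp: bounded_periodic_def\<close>)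
  ultimately have "(\<lambda>s. \<zeta> s * K (t - s)) absolutely_integrable_on {0..T}"
    using absolutely_integrable_periodic_reflect[OF T_pos K_periodic K_integrable]
    by (intro absolutely_integrable_bounded_measurable_product_real) auto
  then show ?thesis by (simp add: absolutely_integrable_on_def mult.commute)
qed

lemma L_cong:
  assumes "bounded_periodic T \<zeta>" "bounded_periodic T \<eta>" "countable E" "\<And>s. s \<notin> E \<Longrightarrow> \<zeta> s = \<eta> s"
  shows "L \<zeta> t = L \<eta> t"
proof -
  have "integral {0..T} (\<lambda>s. K (t - s) * \<zeta> s) = integral {0..T} (\<lambda>s. K (t - s) * \<eta> s)"
    by (rule integral_spike[OF negligible_countable_real[OF assms(3)]]) (use assms(4) in auto)
  then show ?thesis by (simp add: L_eq[OF assms(1)] L_eq[OF assms(2)] average_def)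
qed

lemma bounded_periodic_const: "bounded_periodic T (\<lambda>s. c)"
  by (simp add: bounded_periodic_def periodic_def)

text \<open>The response to 1 shows that the kernel has mean zero over a period, and a constant
  input only scales this mean. Constant waves need this separate treatment because they are not
  signs of z-c functions.\<close>

lemma L_const: "L (\<lambda>s. c) t = 0"
proof -
  have "average T (\<lambda>s. K (t - s) * 1) = 0"
    using L_eq[OF bounded_periodic_const, of 1 t] by (simp add: L_one)
  then have "integral {0..T} (\<lambda>s. K (t - s)) = 0" using T_pos by (simp add: average_def)
  then show ?thesis by (simp add: L_eq[OF bounded_periodic_const] average_def)
qed

text \<open>At fixed \<open>t\<close> all integrands are dominated by
  \<open>\<bar>K (t - s)\<bar>\<close>, which is integrable over a period.\<close>

lemma L_tendsto:
  assumes \<zeta>: "\<And>k. bounded_periodic T (\<zeta> k)" and \<eta>: "bounded_periodic T \<eta>"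
    and le: "\<And>k s. \<bar>\<zeta> k s\<bar> \<le> 1" and E: "countable E"
    and conv: "\<And>s. s \<in> {0..T} \<Longrightarrow> s \<notin> E \<Longrightarrow> (\<lambda>k. \<zeta> k s) \<longlonglongrightarrow> \<eta> s"
  shows "(\<lambda>k. L (\<zeta> k) t) \<longlonglongrightarrow> L \<eta> t"
proof -
  have h: "(\<lambda>s. \<bar>K (t - s)\<bar>) integrable_on {0..T}"
    using absolutely_integrable_periodic_reflect[OF T_pos K_periodic K_integrable, of t]
    by (simp add: absolutely_integrable_on_def)
  have "(\<lambda>k. integral {0..T} (\<lambda>s. K (t - s) * \<zeta> k s)) \<longlonglongrightarrow> integral {0..T} (\<lambda>s. K (t - s) * \<eta> s)"
  proof (rule tendsto_integral_off_countable[OF kernel_product_integrable[OF \<zeta>] h _ E])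
    show "norm (K (t - s) * \<zeta> k s) \<le> \<bar>K (t - s)\<bar>" for k s
      using mult_left_mono[OF le[of k s], of "\<bar>K (t - s)\<bar>"] by (simp add: abs_mult)
    show "(\<lambda>k. K (t - s) * \<zeta> k s) \<longlonglongrightarrow> K (t - s) * \<eta> s" if "s \<in> {0..T}" "s \<notin> E" for s
      by (intro tendsto_intros conv that)
  qed
  then show ?thesis
    unfolding L_eq[OF \<zeta>] L_eq[OF \<eta>] average_def by (intro tendsto_intros)
qed

section \<open>Regular outputs of the loop\<close>

definition loop :: "(real \<Rightarrow> real) \<Rightarrow> real \<Rightarrow> real" where
  "loop \<zeta> t = \<phi> t - \<mu> * L \<zeta> t"

text \<open>The constant signs between zeros are kept without reference to those of
  \<open>\<phi>\<close>. With the first zero in \<open>{0..<T}\<close>, all labelled times lie in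
  \<open>{0..2 * T}\<close>.\<close>

definition regular :: "(real \<Rightarrow> real) \<Rightarrow> bool" where
  "regular g \<longleftrightarrow> zc_function T g \<and> (\<exists>t \<epsilon>. sign_labelling T g m t \<epsilon> \<and> 0 \<le> t 0 \<and> t 0 < T)"

text \<open>The sign of \<open>\<phi>\<close> at one chosen point of its \<open>k\<close>-th arc
  serves as \<open>\<epsilon> k\<close>; counting the zeros of \<open>\<phi>\<close> gives
  \<open>n = m\<close>.\<close>

lemma regularI:
  assumes zc: "zc_function T g" and t\<^sub>o: "zero_labelling T \<phi> n t\<^sub>o" and t: "zero_labelling T g n t"
    and sgn: "\<And>k x y. k < n \<Longrightarrow> t k < x \<Longrightarrow> x < t (Suc k) \<Longrightarrow> t\<^sub>o k < y \<Longrightarrow> y < t\<^sub>o (Suc k) \<Longrightarrow> sgn (g x) = sgn (\<phi> y)"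
  shows "regular g"
proof -
  have per: "periodic T g" "periodic T \<phi>" using zc \<phi>_zc by (simp_all add: zc_function_def)
  have n: "m = n" using zeros_per_period_iff[OF T_pos per(2) t\<^sub>o] \<phi>_zeros by simp
  have "\<exists>y. t\<^sub>o k < y \<and> y < t\<^sub>o (Suc k)" if "k < m" for k
    by (rule dense) (rule zero_labellingD(1)[OF t\<^sub>o], use that n in simp)
  then obtain y where y: "\<And>k. k < m \<Longrightarrow> t\<^sub>o k < y k \<and> y k < t\<^sub>o (Suc k)" by metis
  define \<epsilon> where "\<epsilon> k = sgn (\<phi> (y k))" for k
  have "\<bar>\<epsilon> k\<bar> = 1 \<and> (\<forall>x\<in>{t k<..<t (Suc k)}. sgn (g x) = \<epsilon> k)" if k: "k < m" for k
  proof
    have "\<phi> (y k) \<noteq> 0"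
      by (rule nonzero_between_labelled_zeros[OF t\<^sub>o, of k]) (use y[OF k] k n in simp_all)
    then show "\<bar>\<epsilon> k\<bar> = 1" by (simp add: \<epsilon>_def abs_sgn_eq)
    show "\<forall>x\<in>{t k<..<t (Suc k)}. sgn (g x) = \<epsilon> k"
      unfolding \<epsilon>_def using sgn[of k _ "y k"] k n y[OF k] by simp
  qed
  then have lab: "sign_labelling T g m t \<epsilon>" using t n by (simp add: sign_labelling_def)
  obtain j where j: "0 \<le> t 0 + of_int j * T" "t 0 + of_int j * T < 0 + T"
    using int_shift_into_period[OF T_pos] by metis
  show ?thesis
    unfolding regular_def using zc sign_labelling_shift[OF per(1) lab, of j] j
    by (intro conjI exI[of _ "\<lambda>k. t k + of_int j * T"] exI[of _ \<epsilon>]) simp_all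
qed

lemma regular_features:
  assumes "has_zc_features T \<phi> g"
  shows "regular g"
proof -
  obtain n t\<^sub>o t where "zero_labelling T \<phi> n t\<^sub>o" "zero_labelling T g n t"
    and "\<And>k x y. k < n \<Longrightarrow> x\<in>{t k<..<t (Suc k)} \<Longrightarrow> y\<in>{t\<^sub>o k<..<t\<^sub>o (Suc k)} \<Longrightarrow> sgn (g x) = sgn (\<phi> y)"
    using assms unfolding has_zc_features_def by blast
  then show ?thesis using assms unfolding has_zc_features_def by (intro regularI) auto
qed

text \<open>The features hypothesis at \<open>\<psi> = \<phi>\<close> supplies both a labelling of
  \<open>\<phi>\<close> and an output \<open>g\<close> to compare with. The sign of \<open>g\<close>
  at one point of its arc equals the sign of \<open>\<phi>\<close> at every point of the
  corresponding arc, so the latter is constant.\<close>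

lemma regular_\<phi>: "regular \<phi>"
proof -
  obtain g n t\<^sub>o t where t\<^sub>o: "zero_labelling T \<phi> n t\<^sub>o" and t: "zero_labelling T g n t"
    and sgn: "\<And>k x y. k < n \<Longrightarrow> x\<in>{t k<..<t (Suc k)} \<Longrightarrow> y\<in>{t\<^sub>o k<..<t\<^sub>o (Suc k)} \<Longrightarrow> sgn (g x) = sgn (\<phi> y)"
    using features[OF \<phi>_zc] unfolding has_zc_features_def by blast
  have "sgn (\<phi> x) = sgn (\<phi> y)" if "k < n" "t\<^sub>o k < x" "x < t\<^sub>o (Suc k)" "t\<^sub>o k < y" "y < t\<^sub>o (Suc k)" for k x y
  proof -
    obtain z where "t k < z" "z < t (Suc k)"
      using zero_labellingD(1)[OF t \<open>k < n\<close>] dense by blast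
    then have "z \<in> {t k<..<t (Suc k)}" by simp
    then show ?thesis using sgn[OF \<open>k < n\<close>, of z x] sgn[OF \<open>k < n\<close>, of z y] that by simp
  qed
  then show ?thesis by (rule regularI[OF \<phi>_zc t\<^sub>o t\<^sub>o])
qed

lemma regularD:
  assumes "regular g"
  shows "zc_function T g" "periodic T g" "continuous_on UNIV g"
    and "zeros_per_period T g m" "countable {s. g s = 0}" "bounded_periodic T (\<lambda>s. sgn (g s))"
proof -
  show zc: "zc_function T g" using assms by (simp add: regular_def)
  then show per: "periodic T g" and cont: "continuous_on UNIV g" by (simp_all add: zc_function_def)
  obtain t \<epsilon> where "sign_labelling T g m t \<epsilon>" using assms by (auto simp: regular_def)
  then have lab: "zero_labelling T g m t" by (simp add: sign_labelling_def)
  then show z: "zeros_per_period T g m" using zeros_per_period_iff[OF T_pos per] by simp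
  have "{s. g s = 0} \<subseteq> (\<Union>j::int. (\<lambda>s. s - of_int j * T) ` {s\<in>{0..<T}. g s = 0})"
  proof
    fix s assume s: "s \<in> {s. g s = 0}"
    obtain j where j: "0 \<le> s + of_int j * T" "s + of_int j * T < 0 + T"
      using int_shift_into_period[OF T_pos] by metis
    then have "s \<in> (\<lambda>s. s - of_int j * T) ` {s\<in>{0..<T}. g s = 0}"
      using s periodic_add_int[OF per, of s j] by (intro image_eqI[of _ _ "s + of_int j * T"]) auto
    then show "s \<in> (\<Union>j::int. (\<lambda>s. s - of_int j * T) ` {s\<in>{0..<T}. g s = 0})" by blast
  qed
  moreover have "countable (\<Union>j::int. (\<lambda>s. s - of_int j * T) ` {s\<in>{0..<T}. g s = 0})"
    using z by (intro countable_UN countableI_type countable_image countable_finite) (simp add: zeros_per_period_def)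
  ultimately show "countable {s. g s = 0}" by (rule countable_subset)
  have "g \<in> borel_measurable borel" using cont by (rule borel_measurable_continuous_onI)
  then have "(\<lambda>s. sgn (g s)) \<in> borel_measurable borel" by measurable
  moreover have "bounded (range (\<lambda>s. sgn (g s)))" by (rule boundedI[of _ 1]) (auto simp: sgn_if)
  ultimately show "bounded_periodic T (\<lambda>s. sgn (g s))"
    using per by (simp add: bounded_periodic_def periodic_def)
qed

text \<open>After cancellation the wave is, off a countable set, either constant, in which case the
  loop returns \<open>\<phi>\<close>, or the sign of a z-c function, in which case the features
  hypothesis applies. Changing the input on a countable set does not alter the output. No order of
  the switching times is assumed, so limits of waves are covered too.\<close>

lemma regular_loop_pulse: "regular (loop (pulse T n u b))"
proof -
  obtain S c E where S: "finite S" "S \<subseteq> {0..<T}" "even (card S)" and c: "c = 1 \<or> c = -1" and E: "countable E"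
    and eq: "\<And>s. s \<notin> E \<Longrightarrow> pulse T n u b s = c * (\<Prod>a\<in>S. sgn (half_sine T a s))"
    using switching_wave_pulse[OF T_pos, of n u b] unfolding switching_wave_def by auto
  note bp = bounded_periodic_pulse[OF T_pos, of n u b]
  show ?thesis
  proof (cases "S = {}")
    case True
    then have "L (pulse T n u b) t = L (\<lambda>s. c) t" for t
      by (intro L_cong[OF bp bounded_periodic_const E]) (simp add: eq)
    then have "loop (pulse T n u b) = \<phi>" by (auto simp: loop_def L_const)
    then show ?thesis using regular_\<phi> by simp
  next
    case False
    obtain \<psi> where \<psi>: "zc_function T \<psi>" "\<And>s. sgn (\<psi> s) = c * (\<Prod>a\<in>S. sgn (half_sine T a s))"
      using exists_zc_function_sgn_eq_prod_half_sine[OF T_pos S(1,2) False S(3) c] by blast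
    have "bounded_periodic T (\<lambda>s. sgn (\<psi> s))"
    proof -
      have "\<psi> \<in> borel_measurable borel"
        using \<psi>(1) by (intro borel_measurable_continuous_onI) (simp add: zc_function_def)
      then have "(\<lambda>s. sgn (\<psi> s)) \<in> borel_measurable borel" by measurable
      moreover have "bounded (range (\<lambda>s. sgn (\<psi> s)))" by (rule boundedI[of _ 1]) (auto simp: sgn_if)
      ultimately show ?thesis using \<psi>(1) by (simp add: bounded_periodic_def periodic_def zc_function_def)
    qed
    then have "L (pulse T n u b) t = L (\<lambda>s. sgn (\<psi> s)) t" for t
      by (intro L_cong[OF bp _ E]) (simp_all add: eq \<psi>)
    then have "loop (pulse T n u b) = (\<lambda>t. \<phi> t - \<mu> * L (\<lambda>s. sgn (\<psi> s)) t)" by (auto simp: loop_def)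
    then show ?thesis using regular_features[OF features[OF \<psi>(1)]] by simp
  qed
qed

lemma sgn_loop_tendsto:
  assumes \<zeta>: "\<And>k. bounded_periodic T (\<zeta> k)" "\<And>k s. \<bar>\<zeta> k s\<bar> \<le> 1" and E: "countable E"
    and conv: "\<And>s. s \<in> {0..T} \<Longrightarrow> s \<notin> E \<Longrightarrow> (\<lambda>k. \<zeta> k s) \<longlonglongrightarrow> pulse T n u b s"
    and s: "loop (pulse T n u b) s \<noteq> 0"
  shows "(\<lambda>k. sgn (loop (\<zeta> k) s)) \<longlonglongrightarrow> sgn (loop (pulse T n u b) s)"
  unfolding loop_def
  by (intro tendsto_sgn tendsto_intros L_tendsto[OF \<zeta>(1) bounded_periodic_pulse[OF T_pos] \<zeta>(2) E] conv)
     (use s in \<open>auto simp: loop_def\<close>)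

lemma bounded_periodic_integrable:
  assumes "bounded_periodic T \<zeta>"
  shows "\<zeta> integrable_on {a..b}"
proof -
  have "\<zeta> \<in> borel_measurable (lebesgue_on {a..b})"
    using assms by (intro measurable_restrict_space1 measurable_completion) (simp add: bounded_periodic_def)
  moreover have "bounded (\<zeta> ` {a..b})"
    by (rule bounded_subset[of "range \<zeta>"]) (use assms in \<open>auto simp: bounded_periodic_def\<close>)
  moreover have "(\<lambda>s. 1 :: real) absolutely_integrable_on {a..b}"
    by (simp add: absolutely_integrable_on_def integrable_const_ivl)
  ultimately have "(\<lambda>s. \<zeta> s * 1) absolutely_integrable_on {a..b}"
    by (intro absolutely_integrable_bounded_measurable_product_real) auto
  then show ?thesis by (simp add: absolutely_integrable_on_def)
qed

section \<open>Pulse-width modulation and its fixed points\<close>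

definition node :: "nat \<Rightarrow> nat \<Rightarrow> real" where
  "node N i = real i * T / real N"

definition modulated :: "nat \<Rightarrow> (nat \<Rightarrow> real) \<Rightarrow> real \<Rightarrow> real" where
  "modulated N x = pulse T N (node N) (\<lambda>i. node N i + x i * (T / real N))"

text \<open>If \<open>g\<close> vanishes only on a null set, this is the proportion of the cell on which \<open>g\<close> is negative.\<close>

definition negative_share :: "nat \<Rightarrow> (real \<Rightarrow> real) \<Rightarrow> nat \<Rightarrow> real" where
  "negative_share N g i =
     (1 - real N / T * integral {node N i..node N (Suc i)} (\<lambda>s. sgn (g s))) / 2"

lemma node_Suc: "node N (Suc i) = node N i + T / real N"
  by (simp add: node_def distrib_right add_divide_distrib)

lemma node_le: "node N i \<le> node N (Suc i)"
  using T_pos by (simp add: node_Suc)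

lemma negative_share_const:
  assumes "N > 0" "\<And>s. s \<in> {node N i..node N (Suc i)} \<Longrightarrow> sgn (g s) = c"
  shows "negative_share N g i = (1 - c) / 2"
proof -
  have "integral {node N i..node N (Suc i)} (\<lambda>s. sgn (g s)) = integral {node N i..node N (Suc i)} (\<lambda>s. c)"
    by (rule integral_cong) (use assms(2) in simp)
  also have "\<dots> = c * (T / real N)" using T_pos by (simp add: node_Suc)
  finally show ?thesis using assms(1) T_pos by (simp add: negative_share_def)
qed

lemma negative_share_unit:
  assumes N: "N > 0" and g: "regular g"
  shows "0 \<le> negative_share N g i \<and> negative_share N g i \<le> 1"
proof -
  let ?I = "integral {node N i..node N (Suc i)} (\<lambda>s. sgn (g s))"
  have "norm ?I \<le> integral {node N i..node N (Suc i)} (\<lambda>s. 1)"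
    by (rule integral_norm_bound_integral[OF bounded_periodic_integrable[OF regularD(6)[OF g]]])
       (auto simp: sgn_if integrable_const_ivl)
  also have "\<dots> = T / real N" using T_pos by (simp add: node_Suc)
  finally have "\<bar>?I\<bar> \<le> T / real N" by simp
  then have "real N / T * \<bar>?I\<bar> \<le> real N / T * (T / real N)"
    using T_pos by (intro mult_left_mono) simp_all
  also have "\<dots> = 1" using N T_pos by simp
  finally have "\<bar>real N / T * ?I\<bar> \<le> 1" using T_pos by (simp add: abs_mult)
  then have "real N / T * ?I \<le> 1" "- 1 \<le> real N / T * ?I" by linarith+
  then show ?thesis unfolding negative_share_def by (simp add: field_simps)
qed

text \<open>The factors at the nodes do not depend on \<open>k\<close>, so only the moving switching
  times have to stay away from \<open>s\<close> in the limit.\<close>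

lemma modulated_tendsto:
  assumes "\<And>i. i < N \<Longrightarrow> (\<lambda>k. X k i) \<longlonglongrightarrow> x i"
    and "\<And>i. i < N \<Longrightarrow> half_sine T (node N i + x i * (T / real N)) s \<noteq> 0"
  shows "(\<lambda>k. modulated N (X k) s) \<longlonglongrightarrow> modulated N x s"
  unfolding modulated_def pulse_def
proof (intro tendsto_intros tendsto_prod tendsto_sgn)
  fix i assume "i \<in> {..<N}"
  then have i: "i < N" by simp
  show "half_sine T (node N i + x i * (T / real N)) s \<noteq> 0" by (rule assms(2)[OF i])
  show "(\<lambda>k. half_sine T (node N i + X k i * (T / real N)) s) \<longlonglongrightarrow>
      half_sine T (node N i + x i * (T / real N)) s"
    unfolding half_sine_def by (intro tendsto_intros assms(1)[OF i]) (use T_pos in simp)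
qed

text \<open>Brouwer applies because the discontinuity of \<open>sgn\<close> is harmless: the
  limiting output is regular, so it has countably many zeros, and off them the signs of the outputs
  converge; dominated convergence then gives continuity of the shares.\<close>

lemma exists_self_consistent_modulation:
  assumes N: "N > 0"
  shows "\<exists>x. \<forall>i<N. 0 \<le> x i \<and> x i \<le> 1 \<and> negative_share N (loop (modulated N x)) i = x i"
proof (rule brouwer_unit_cube_nat)
  fix x i
  show "0 \<le> negative_share N (loop (modulated N x)) i \<and> negative_share N (loop (modulated N x)) i \<le> 1"
    by (rule negative_share_unit[OF N]) (simp add: modulated_def regular_loop_pulse)
next
  fix X :: "nat \<Rightarrow> nat \<Rightarrow> real" and x i
  assume X: "\<And>j. j < N \<Longrightarrow> (\<lambda>k. X k j) \<longlonglongrightarrow> x j"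
  have reg: "regular (loop (modulated N x))" for x by (simp add: modulated_def regular_loop_pulse)
  \<comment> \<open>These are the moving switching times of the limit wave, with their translates;
    off them the waves converge.\<close>
  define E where "E = (\<Union>i\<in>{..<N}. {s. half_sine T (node N i + x i * (T / real N)) s = 0})"
  have E: "countable E"
    unfolding E_def by (intro countable_UN countable_half_sine_zeros T_pos) simp
  have lim: "(\<lambda>k. sgn (loop (modulated N (X k)) s)) \<longlonglongrightarrow> sgn (loop (modulated N x) s)"
    if "loop (modulated N x) s \<noteq> 0" for s
    unfolding modulated_def[of N x]
  proof (rule sgn_loop_tendsto[OF _ _ E])
    show "bounded_periodic T (modulated N (X k))" for k
      unfolding modulated_def by (rule bounded_periodic_pulse[OF T_pos])
    show "\<bar>modulated N (X k) s\<bar> \<le> 1" for k s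
      unfolding modulated_def by (rule abs_pulse_le_1)
    show "(\<lambda>k. modulated N (X k) s) \<longlonglongrightarrow> pulse T N (node N) (\<lambda>i. node N i + x i * (T / real N)) s"
      if "s \<notin> E" for s
      unfolding modulated_def[of N x, symmetric]
      by (rule modulated_tendsto[OF X]) (use that in \<open>auto simp: E_def\<close>)
    show "loop (pulse T N (node N) (\<lambda>i. node N i + x i * (T / real N))) s \<noteq> 0"
      using that by (simp add: modulated_def)
  qed
  have "(\<lambda>k. integral {node N i..node N (Suc i)} (\<lambda>s. sgn (loop (modulated N (X k)) s))) \<longlonglongrightarrow>
      integral {node N i..node N (Suc i)} (\<lambda>s. sgn (loop (modulated N x) s))"
    by (rule tendsto_integral_off_countable[where h = "\<lambda>s. 1",
          OF bounded_periodic_integrable[OF regularD(6)[OF reg]] integrable_const_ivl _ regularD(5)[OF reg[of x]]])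
       (use lim in \<open>auto simp: sgn_if\<close>)
  then show "(\<lambda>k. negative_share N (loop (modulated N (X k))) i) \<longlonglongrightarrow> negative_share N (loop (modulated N x)) i"
    unfolding negative_share_def by (intro tendsto_intros) auto
qed

section \<open>Passage to the limit of fine cells\<close>

lemma exists_regular_solution: "\<exists>f. regular f \<and> (\<forall>t. f t = loop (\<lambda>s. sgn (f s)) t)"
proof -
  have "\<forall>n. \<exists>x. \<forall>i<Suc n. 0 \<le> x i \<and> x i \<le> 1 \<and> negative_share (Suc n) (loop (modulated (Suc n) x)) i = x i"
    using exists_self_consistent_modulation by blast
  then obtain x where "\<forall>n. \<forall>i<Suc n. 0 \<le> x n i \<and> x n i \<le> 1 \<and>
      negative_share (Suc n) (loop (modulated (Suc n) (x n))) i = x n i"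
    by (rule choice[THEN exE])
  then have x: "0 \<le> x n i \<and> x n i \<le> 1" "negative_share (Suc n) (loop (modulated (Suc n) (x n))) i = x n i"
    if "i < Suc n" for n i
    using that by simp_all
  define \<zeta> where "\<zeta> n = modulated (Suc n) (x n)" for n
  define g where "g n = loop (\<zeta> n)" for n
  have reg: "regular (g n)" for n by (simp add: g_def \<zeta>_def modulated_def regular_loop_pulse)
  have "\<forall>n. \<exists>p. sign_labelling T (g n) m (fst p) (snd p) \<and> 0 \<le> fst p 0 \<and> fst p 0 < T"
    using reg unfolding regular_def by simp
  then obtain p where p: "\<forall>n. sign_labelling T (g n) m (fst (p n)) (snd (p n)) \<and> 0 \<le> fst (p n) 0 \<and> fst (p n) 0 < T"
    by (rule choice[THEN exE])
  define t where "t n = fst (p n)" for n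
  define \<epsilon> where "\<epsilon> n = snd (p n)" for n
  have lab: "zero_labelling T (g n) m (t n)" and t0: "0 \<le> t n 0" "t n 0 < T"
    and \<epsilon>: "k < m \<Longrightarrow> \<bar>\<epsilon> n k\<bar> = 1"
    and sg: "k < m \<Longrightarrow> t n k < y \<Longrightarrow> y < t n (Suc k) \<Longrightarrow> sgn (g n y) = \<epsilon> n k" for n k y
    using p by (auto simp: sign_labelling_def t_def \<epsilon>_def)
  have t_range: "0 \<le> t n k" "t n k \<le> T + T" if "k \<le> m" for n k
  proof -
    have "t n 0 \<le> t n k" by (rule zero_labelling_mono[OF lab]) (use that in simp_all)
    moreover have "t n k \<le> t n m" by (rule zero_labelling_mono[OF lab]) (use that in simp_all)
    ultimately show "0 \<le> t n k" "t n k \<le> T + T" using t0[of n] zero_labellingD(2)[OF lab, of n] by linarith+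
  qed
  \<comment> \<open>The zeros, \<open>t n m\<close> included, and then the \<open>m\<close> signs
    form one bounded vector, so a single subsequence serves them all.\<close>
  define X where "X n i = (if i \<le> m then t n i else \<epsilon> n (i - Suc m))" for n i
  have X: "\<bar>X n i\<bar> \<le> T + T + 1" if "i < Suc m + m" for n i
    using that t_range[of i n] \<epsilon>[of "i - Suc m" n] T_pos by (auto simp: X_def)
  obtain r l where r: "strict_mono r" and l: "\<And>i. i < Suc m + m \<Longrightarrow> (\<lambda>n. X (r n) i) \<longlonglongrightarrow> l i"
    by (rule bounded_coordinates_convergent_subsequence[of "Suc m + m" X "T + T + 1"], erule X, rule that)
  define \<delta> where "\<delta> k = l (Suc m + k)" for k
  have t_lim: "(\<lambda>n. t (r n) k) \<longlonglongrightarrow> l k" if "k \<le> m" for k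
    using l[of k] that by (simp add: X_def)
  have \<epsilon>_lim: "(\<lambda>n. \<epsilon> (r n) k) \<longlonglongrightarrow> \<delta> k" if "k < m" for k
    using l[of "Suc m + k"] that by (simp add: X_def \<delta>_def)
  have \<delta>1: "\<bar>\<delta> k\<bar> = 1" if "k < m" for k
    using tendsto_rabs[OF \<epsilon>_lim[OF that]] \<epsilon>[OF that] by (simp add: LIMSEQ_const_iff)
  \<comment> \<open>Numbers of absolute value 1 at distance less than 1 coincide, so convergent
    signs are eventually constant.\<close>
  have \<epsilon>_ev: "\<forall>\<^sub>F n in sequentially. \<epsilon> (r n) k = \<delta> k" if "k < m" for k
  proof -
    have "\<forall>\<^sub>F n in sequentially. dist (\<epsilon> (r n) k) (\<delta> k) < 1"
      using \<epsilon>_lim[OF that] by (rule tendstoD) simp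
    then show ?thesis
    proof eventually_elim
      case (elim n)
      then show ?case using \<epsilon>[OF that, of "r n"] \<delta>1[OF that] by (auto simp: dist_real_def abs_if split: if_splits)
    qed
  qed
  have l_mono: "l k \<le> l (Suc k)" if "k < m" for k
    by (rule LIMSEQ_le[OF t_lim t_lim]) (use that zero_labellingD(1)[OF lab, of k] in \<open>auto intro: less_imp_le\<close>)
  have l_m: "l m = l 0 + T"
  proof (rule LIMSEQ_unique[OF t_lim])
    show "(\<lambda>n. t (r n) m) \<longlonglongrightarrow> l 0 + T"
      unfolding zero_labellingD(2)[OF lab] by (intro tendsto_intros t_lim) simp
  qed simp
  \<comment> \<open>A switch at the left end makes the whole arc 1, one at the right end makes it
    -1. Thus the limiting sign pattern is again a pulse wave, even if limits of zeros coincide and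
    some arcs are empty.\<close>
  define b where "b k = (if \<delta> k = 1 then l k else l (Suc k))" for k
  define \<sigma> where "\<sigma> = pulse T m l b"
  define E where "E = (\<Union>k\<in>{..m}. {s. half_sine T (l k) s = 0})"
  have E: "countable E"
    unfolding E_def by (intro countable_UN countable_half_sine_zeros T_pos) simp
  \<comment> \<open>The sign must settle on a whole neighbourhood of \<open>s\<close>, independent
    of \<open>n\<close>, so that it eventually contains the cell around \<open>s\<close>.\<close>
  have settled: "\<exists>d>0. \<forall>\<^sub>F n in sequentially. \<forall>y. \<bar>y - s\<bar> < d \<longrightarrow> sgn (g (r n) y) = \<sigma> s"
    and \<sigma>1: "\<bar>\<sigma> s\<bar> = 1" if s: "s \<notin> E" for s
  proof -
    obtain j where j: "l 0 \<le> s + of_int j * T" "s + of_int j * T < l 0 + T"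
      using int_shift_into_period[OF T_pos] by metis
    define s' where "s' = s + of_int j * T"
    obtain k where k: "k < m" "l k \<le> s'" "s' < l (Suc k)"
      using exists_cell[of l s' m] j l_m unfolding s'_def by auto
    have "s' \<noteq> l k"
    proof
      assume "s' = l k"
      then have "s = l k + of_int (- j) * T" by (simp add: s'_def algebra_simps)
      then have "half_sine T (l k) s = 0" unfolding half_sine_eq_0_iff[OF T_pos] by blast
      then show False using s k by (auto simp: E_def)
    qed
    then have lk: "l k < s'" using k by simp
    have "pulse T m l b s' = (if s' < b k then -1 else 1)"
      by (rule pulse_on_cell[OF T_pos l_mono l_m _ k(1) lk k(3)])
         (use l_mono lk k in \<open>auto simp: b_def\<close>)
    also have "\<dots> = \<delta> k" using lk k \<delta>1[OF k(1)] by (auto simp: b_def abs_if split: if_splits)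
    also have "pulse T m l b s' = \<sigma> s"
      unfolding s'_def \<sigma>_def by (rule periodic_add_int[OF periodic_pulse[OF T_pos]])
    finally have \<sigma>: "\<sigma> s = \<delta> k" .
    then show "\<bar>\<sigma> s\<bar> = 1" using \<delta>1[OF k(1)] by simp
    \<comment> \<open>The points \<open>a\<close> and \<open>c\<close> leave a margin inside the
      limiting arc: eventually the zeros \<open>t (r n) k\<close> and \<open>t (r n) (Suc k)\<close>
      lie outside the interval from \<open>a\<close> to \<open>c\<close>.\<close>
    obtain a c where a: "l k < a" "a < s'" and c: "s' < c" "c < l (Suc k)"
      using dense lk k(3) by metis
    have "\<forall>\<^sub>F n in sequentially. t (r n) k < a"
      using order_tendstoD(2)[OF t_lim a(1)] k(1) by simp
    moreover have "\<forall>\<^sub>F n in sequentially. c < t (r n) (Suc k)"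
      using order_tendstoD(1)[OF t_lim c(2)] k(1) by simp
    ultimately have "\<forall>\<^sub>F n in sequentially. \<forall>y. \<bar>y - s\<bar> < min (s' - a) (c - s') \<longrightarrow> sgn (g (r n) y) = \<sigma> s"
      using \<epsilon>_ev[OF k(1)]
    proof eventually_elim
      case (elim n)
      show ?case
      proof (intro allI impI)
        fix y assume "\<bar>y - s\<bar> < min (s' - a) (c - s')"
        then have "a < y + of_int j * T" "y + of_int j * T < c" unfolding s'_def by linarith+
        then have "sgn (g (r n) (y + of_int j * T)) = \<epsilon> (r n) k"
          by (intro sg[OF k(1)]) (use elim in linarith)+
        then show "sgn (g (r n) y) = \<sigma> s"
          using elim \<sigma> periodic_add_int[OF regularD(2)[OF reg], of "r n" y j] by simp
      qed
    qed
    moreover have "min (s' - a) (c - s') > 0" using a c by simp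
    ultimately show "\<exists>d>0. \<forall>\<^sub>F n in sequentially. \<forall>y. \<bar>y - s\<bar> < d \<longrightarrow> sgn (g (r n) y) = \<sigma> s" by blast
  qed
  \<comment> \<open>The nodes of all partitions are excluded, so that \<open>s\<close> is always
    interior to its cell.\<close>
  define E1 where "E1 = (\<Union>n. range (node (Suc n)))"
  have E1: "countable (E \<union> E1)" unfolding E1_def using E by simp
  \<comment> \<open>Once the cell around \<open>s\<close> is narrower than \<open>d\<close>, the
    output has constant sign on it. Its negative share is then 0 or 1, and the fixed-point equation
    makes the wave equal to that sign on the interior of the cell.\<close>
  have cells: "\<forall>\<^sub>F n in sequentially. \<zeta> (r n) s = \<sigma> s" if s: "s \<in> {0..T}" "s \<notin> E \<union> E1" for s
  proof -
    obtain d where d: "d > 0" and ev: "\<forall>\<^sub>F n in sequentially. \<forall>y. \<bar>y - s\<bar> < d \<longrightarrow> sgn (g (r n) y) = \<sigma> s"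
      using settled(1)[of s] s(2) by blast
    have "(\<lambda>n. T * (1 / real (Suc (r n)))) \<longlonglongrightarrow> T * 0"
      using LIMSEQ_subseq_LIMSEQ[OF LIMSEQ_inverse_real_of_nat r]
      by (intro tendsto_mult_left) (simp add: o_def inverse_eq_divide)
    then have "\<forall>\<^sub>F n in sequentially. T * (1 / real (Suc (r n))) < d"
      by (rule order_tendstoD(2)) (use d in simp)
    with ev show ?thesis
    proof eventually_elim
      case (elim n)
      define N where "N = Suc (r n)"
      have N: "N > 0" by (simp add: N_def)
      have width: "T / real N < d" using elim by (simp add: N_def)
      have ne: "s \<noteq> node N i" for i using s(2) unfolding E1_def N_def by blast
      have nN: "node N N = T" "node N 0 = 0" using N by (simp_all add: node_def)
      obtain i where i: "i < N" "node N i \<le> s" "s < node N (Suc i)"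
        using exists_cell[of "node N" s N] nN s(1) ne[of N] by (auto simp: order_le_less)
      have lt: "node N i < s" using i ne[of i] by simp
      have "sgn (g (r n) y) = \<sigma> s" if "y \<in> {node N i..node N (Suc i)}" for y
      proof -
        have "node N i \<le> y" "y \<le> node N i + T / real N" using that by (simp_all add: node_Suc)
        then have "\<bar>y - s\<bar> < d" using lt i width node_Suc[of N i] by linarith
        then show ?thesis using elim by blast
      qed
      then have "negative_share N (g (r n)) i = (1 - \<sigma> s) / 2"
        by (rule negative_share_const[OF N])
      moreover have "negative_share N (g (r n)) i = x (r n) i"
        using x(2)[of i "r n"] i(1) by (simp add: N_def g_def \<zeta>_def)
      ultimately have xi: "x (r n) i = (1 - \<sigma> s) / 2" by simp
      have \<sigma>s: "\<sigma> s = 1 \<or> \<sigma> s = -1" using \<sigma>1[of s] s by (auto simp: abs_if split: if_splits)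
      have "\<zeta> (r n) s = pulse T N (node N) (\<lambda>i. node N i + x (r n) i * (T / real N)) s"
        by (simp add: \<zeta>_def modulated_def N_def)
      also have "\<dots> = (if s < node N i + x (r n) i * (T / real N) then -1 else 1)"
      proof (rule pulse_on_cell[OF T_pos node_le _ _ i(1) lt i(3)])
        show "node N N = node N 0 + T" using nN by simp
        \<comment> \<open>As \<open>x (r n) i\<close> is 0 or 1, the switch sits at a node, which
          \<open>s\<close> avoids.\<close>
        show "s \<noteq> node N i + x (r n) i * (T / real N)"
          using \<sigma>s ne[of i] ne[of "Suc i"] xi by (auto simp: node_Suc)
        fix k assume k: "k < N"
        have "0 \<le> x (r n) k" "x (r n) k \<le> 1" using x(1)[of k "r n"] k by (simp_all add: N_def)
        then have "0 \<le> x (r n) k * (T / real N)" "x (r n) k * (T / real N) \<le> 1 * (T / real N)"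
          using T_pos by (simp, intro mult_right_mono) simp_all
        then show "node N k \<le> node N k + x (r n) k * (T / real N) \<and>
            node N k + x (r n) k * (T / real N) \<le> node N (Suc k)"
          by (simp add: node_Suc)
      qed
      also have "\<dots> = \<sigma> s" using \<sigma>s xi lt i(3) by (auto simp: node_Suc)
      finally show ?case .
    qed
  qed
  have \<zeta>bp: "bounded_periodic T (\<zeta> n)" for n
    unfolding \<zeta>_def modulated_def by (rule bounded_periodic_pulse[OF T_pos])
  have \<zeta>1: "\<bar>\<zeta> n s\<bar> \<le> 1" for n s unfolding \<zeta>_def modulated_def by (rule abs_pulse_le_1)
  define f where "f = loop \<sigma>"
  \<comment> \<open>Since \<open>\<sigma>\<close> is itself a pulse wave, the zeros of
    \<open>f\<close> are controlled directly by the features hypothesis. No argument that the zeros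
    of \<open>g (r n)\<close> stay apart in the limit is required.\<close>
  have regf: "regular f" unfolding f_def \<sigma>_def by (rule regular_loop_pulse)
  \<comment> \<open>The signs of \<open>g (r n) s\<close> have two limits: \<open>sgn (f s)\<close>,
    because the input waves converge to \<open>\<sigma>\<close>, and \<open>\<sigma> s\<close>,
    because the sign has settled near \<open>s\<close>.\<close>
  have sgnf: "sgn (f s) = \<sigma> s" if "s \<notin> E \<union> {s. f s = 0}" for s
  proof (rule LIMSEQ_unique)
    show "(\<lambda>n. sgn (g (r n) s)) \<longlonglongrightarrow> sgn (f s)"
      unfolding g_def f_def \<sigma>_def
    proof (rule sgn_loop_tendsto[OF \<zeta>bp \<zeta>1 E1])
      show "loop (pulse T m l b) s \<noteq> 0" using that by (simp add: f_def \<sigma>_def)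
      show "(\<lambda>n. \<zeta> (r n) s) \<longlonglongrightarrow> pulse T m l b s" if "s \<in> {0..T}" "s \<notin> E \<union> E1" for s
        using tendsto_eventually[OF cells[OF that]] by (simp add: \<sigma>_def)
    qed
    have "s \<notin> E" using that by simp
    from settled(1)[OF this]     obtain d where "d > 0" "\<forall>\<^sub>F n in sequentially. \<forall>y. \<bar>y - s\<bar> < d \<longrightarrow> sgn (g (r n) y) = \<sigma> s"
      by blast
    from this(2) have "\<forall>\<^sub>F n in sequentially. sgn (g (r n) s) = \<sigma> s"
      by (rule eventually_mono) (use \<open>d > 0\<close> in simp)
    then show "(\<lambda>n. sgn (g (r n) s)) \<longlonglongrightarrow> \<sigma> s" by (rule tendsto_eventually)
  qed
  have "L (\<lambda>s. sgn (f s)) t = L \<sigma> t" for t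
  proof (rule L_cong[OF regularD(6)[OF regf]])
    show "bounded_periodic T \<sigma>" unfolding \<sigma>_def by (rule bounded_periodic_pulse[OF T_pos])
    show "countable (E \<union> {s. f s = 0})" using E regularD(5)[OF regf] by simp
  qed (rule sgnf)
  then have "f t = loop (\<lambda>s. sgn (f s)) t" for t by (simp add: f_def loop_def)
  with regf show ?thesis by blast
qed

end

section \<open>The loop equation for an admissible operator\<close>

theorem theorem1:
  fixes T \<mu> :: real and \<phi> :: "real \<Rightarrow> real"
    and L :: "(real \<Rightarrow> real) \<Rightarrow> real \<Rightarrow> real" and m\<^sub>o :: nat
  assumes "T > 0"
    and "zc_function T \<phi>"
    and "zeros_per_period T \<phi> m\<^sub>o"
    and "admissible_operator T L"
    and "\<mu> > 0"
    and "\<And>\<psi>. zc_function T \<psi> \<Longrightarrow>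
           has_zc_features T \<phi> (\<lambda>t. \<phi> t - \<mu> * L (\<lambda>s. sgn (\<psi> s)) t)"
  shows "\<exists>f. zc_function T f \<and> zeros_per_period T f m\<^sub>o \<and>
           (\<forall>t. f t = \<phi> t - \<mu> * L (\<lambda>s. sgn (f s)) t)"
proof -
  obtain K where K: "periodic T K" "K absolutely_integrable_on {0..T}"
    and "\<forall>\<zeta>. bounded_periodic T \<zeta> \<longrightarrow> (\<forall>t. L \<zeta> t = average T (\<lambda>s. K (t - s) * \<zeta> s))"
    using assms(4) unfolding admissible_operator_def by blast
  then have K_eq: "\<And>\<zeta> t. bounded_periodic T \<zeta> \<Longrightarrow> L \<zeta> t = average T (\<lambda>s. K (t - s) * \<zeta> s)"
    by simp
  have L1: "L (\<lambda>t. 1) = (\<lambda>t. 0)" using assms(4) unfolding admissible_operator_def by blast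
  interpret relay_loop T \<mu> \<phi> K L m\<^sub>o
    by unfold_locales (fact assms K K_eq L1)+
  obtain f where f: "regular f" "\<forall>t. f t = loop (\<lambda>s. sgn (f s)) t"
    using exists_regular_solution by blast
  show ?thesis
    by (rule exI[of _ f], intro conjI, rule regularD(1)[OF f(1)], rule regularD(4)[OF f(1)],
        rule f(2)[unfolded loop_def])
qed
end
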